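(* Let $(\Omega,\mathcal F,(\mathcal F_t)_{t=0}^T,P)$ be a complete filtered probability space, let $n=n_0+\cdots+n_T$, and let $h:\mathbb R^n\times\Omega\to\overline{\mathbb R}$ be an $\mathcal F$-normal integrand such that $h\ge m$ for some $m\in L^1(\Omega,\mathcal F,P)$. Let $\mathcal N$, the problem $(P)$ of minimizing $Eh(x)$ over $x\in\mathcal N$, its infimum $\inf(P)$, and the functions $h_t,\tilde h_t$ be as defined in the context. Assume that, for each $t$, $h_t^\infty(0,x_t)>0$ for all $x_t\in\mathbb R^{n_t}\setminus\{0\}$ ($P$-almost surely) whenever $h_t$ is well-defined. Then $h_t$ is well-defined for all $t=T,\ldots,0$ and $$Eh_t(x^t)\ge \inf (P),\qquad t=0,\ldots,T,\quad \forall x\in\mathcal N. \qquad ( * )$$ Optimal solutions $x\in\mathcal N$ of $(P)$ exist and they are characterized by the condition $$x_t(\omega)\in\operatorname*{argmin}_{x_t\in\mathbb R^{n_t}}h_t(x^{t-1}(\omega),x_t,\omega)\quad P\text{-a.s.},\quad t=0,\ldots,T,$$ which is equivalent to having equalities in $( * )$ for all $t=0,\ldots,T$.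
   Context: A $\mathcal G$-normal integrand on $\mathbb R^k\times\Omega$ (for a $\sigma$-algebra $\mathcal G\subseteq\mathcal F$) is an extended real-valued $\mathcal B(\mathbb R^k)\otimes\mathcal G$-measurable function $g$ such that $g(\cdot,\omega)$ is lower semicontinuous for every $\omega$. Properties of normal integrands (positivity, inequalities, etc.) are understood $P$-almost surely, i.e. they hold for $g(\cdot,\omega)$ for all $\omega$ in a set of probability one. $\mathcal N:=\{(x_t)_{t=0}^T \mid x_t\in L^0(\Omega,\mathcal F_t,P;\mathbb R^{n_t})\}$ for given integers $n_t$ with $n_0+\cdots+n_T=n$. For $x\in\mathcal N$, $Eh(x):=\int h(x(\omega),\omega)\,dP(\omega)$, and similarly $Eh_t(x^t):=\int h_t(x^t(\omega),\omega)\,dP(\omega)$. Problem $(P)$: minimize $Eh(x)$ over $x\in\mathcal N$; $\inf(P):=\inf_{x\in\mathcal N}Eh(x)$; an optimal solution is an $x\in\mathcal N$ with $Eh(x)=\inf(P)$. Notation: $x^t=(x_0,\ldots,x_t)$ (with $x^{-1}$ void). Conditional expectation of an integrand: for a $\sigma$-algebra $\mathcal G\subseteq\mathcal F$ and a normal integrand $g$ bounded from below by an integrable random variable, $E^{\mathcal G}g$ denotes the $\mathcal G$-normal integrand such that $(E^{\mathcal G}g)(x)=E^{\mathcal G}[g(x)]$ for all $x\in L^0(\Omega,\mathcal G,P;\mathbb R^k)$ (it is known that it exists and is bounded below by the conditional expectation of the lower bound of $g$). Write $E_t=E^{\mathcal F_t}$. The functions $h_t,\tilde h_t:\mathbb R^{n_0+\cdots+n_t}\times\Omega\to\overline{\mathbb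 R}$ are defined recursively for $t=T,\ldots,0$ by $$\tilde h_T=h,\qquad h_t=E_t\tilde h_t,\qquad \tilde h_{t-1}(x^{t-1},\omega)=\inf_{x_t\in\mathbb R^{n_t}}h_t(x^{t-1},x_t,\omega).$$ "$h_t$ is well-defined" means that the recursion can be carried out down to $t$, i.e. $\tilde h_T,\ldots,\tilde h_t$ are normal integrands whose conditional integrands exist. Horizon function: for $g:\mathbb R^k\to\overline{\mathbb R}$, $$g^\infty(w):=\lim_{\delta\searrow0}\ \inf_{\lambda\in(0,\delta),\ w'\in\mathbb B(w,\delta)}\lambda g(w'/\lambda),$$ where $\mathbb B(w,\delta)$ is the closed ball of radius $\delta$ around $w$. For an integrand, $g^\infty(\cdot,\omega)$ is the horizon function of $g(\cdot,\omega)$. In $h_t^\infty(0,x_t)$ the $0$ is the zero vector of $\mathbb R^{n_0+\cdots+n_{t-1}}$.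
   Formalization: That optimality (or equality in ( * ) for all t) implies the argmin condition is claimed only if inf(P)<+∞; otherwise it fails: T=0, F_0=F, h(x,ω)=|x|+Y(ω), Y≥0, EY=∞. Normality of \tilde h_t is understood almost surely. *)

theory Defs
  imports "HOL-Probability.Probability"
begin

section \<open>Euclidean spaces of varying dimension\<close>

text \<open>Since the dimensions n 0, ..., n T are data, points of k-dimensional space are represented
  as in the library theory \<open>Abstract_Euclidean_Space\<close>: real sequences that vanish from index k on.
  On this set the product topology of the type \<open>nat \<Rightarrow> real\<close> is the Euclidean topology, and
  its Borel sets are the traces of the Borel sets of that type.\<close>

definition Rn :: "nat \<Rightarrow> (nat \<Rightarrow> real) set" where
  "Rn k = {x. \<forall>i\<ge>k. x i = 0}"

lemma Rn_eq_topspace_Euclidean_space: "Rn k = topspace (Euclidean_space k)"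
  by (simp add: Rn_def topspace_Euclidean_space)

lemma top_of_set_Rn_eq_Euclidean_space: "top_of_set (Rn k) = Euclidean_space k"
  by (simp add: Rn_def Euclidean_space_def euclidean_product_topology)

abbreviation borel_Rn :: "nat \<Rightarrow> (nat \<Rightarrow> real) measure" where
  "borel_Rn k \<equiv> restrict_space borel (Rn k)"

definition cball_Rn :: "nat \<Rightarrow> (nat \<Rightarrow> real) \<Rightarrow> real \<Rightarrow> (nat \<Rightarrow> real) set" where
  "cball_Rn k w \<delta> = {w' \<in> Rn k. L2_set (\<lambda>i. w' i - w i) {..<k} \<le> \<delta>}"

text \<open>Concatenation (u, v) of a point u of k-dimensional space with a further vector v.\<close>

definition cat :: "nat \<Rightarrow> (nat \<Rightarrow> real) \<Rightarrow> (nat \<Rightarrow> real) \<Rightarrow> nat \<Rightarrow> real" where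
  "cat k u v = (\<lambda>i. if i < k then u i else v (i - k))"

lemma cat_in_Rn: "v \<in> Rn m \<Longrightarrow> cat k u v \<in> Rn (k + m)"
  by (auto simp: Rn_def cat_def)

text \<open>\<open>total_dim n t\<close> is the total dimension of the blocks 0, ..., t - 1.\<close>

definition total_dim :: "(nat \<Rightarrow> nat) \<Rightarrow> nat \<Rightarrow> nat" where
  "total_dim n t = (\<Sum>s<t. n s)"

text \<open>\<open>hist n x t \<omega>\<close> is the vector of the first t blocks x 0, ..., x (t - 1) at \<open>\<omega>\<close>, so
  the vector usually written with superscript t is \<open>hist n x (Suc t) \<omega>\<close>.\<close>

primrec hist :: "(nat \<Rightarrow> nat) \<Rightarrow> (nat \<Rightarrow> 'a \<Rightarrow> nat \<Rightarrow> real) \<Rightarrow> nat \<Rightarrow> 'a \<Rightarrow> nat \<Rightarrow> real" where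
  "hist n x 0 \<omega> = (\<lambda>_. 0)"
| "hist n x (Suc t) \<omega> = cat (total_dim n t) (hist n x t \<omega>) (x t \<omega>)"


section \<open>Normal integrands\<close>

definition lsc_on :: "'b::topological_space set \<Rightarrow> ('b \<Rightarrow> ereal) \<Rightarrow> bool" where
  "lsc_on A f \<longleftrightarrow> (\<forall>x\<in>A. f x \<le> Liminf (at x within A) f)"

text \<open>Only the values of an integrand on \<open>Rn k \<times> space G\<close> are relevant.\<close>

definition normal_integrand :: "'a measure \<Rightarrow> nat \<Rightarrow> ((nat \<Rightarrow> real) \<Rightarrow> 'a \<Rightarrow> ereal) \<Rightarrow> bool" where
  "normal_integrand G k g \<longleftrightarrow>
     (\<lambda>(x, \<omega>). g x \<omega>) \<in> borel_measurable (borel_Rn k \<Otimes>\<^sub>M G) \<and>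
     (\<forall>\<omega>\<in>space G. lsc_on (Rn k) (\<lambda>x. g x \<omega>))"

text \<open>Normality up to a null set. This is what can be expected of functions obtained by partial
  minimization, where lower semicontinuity only holds almost surely.\<close>

definition AE_normal_integrand :: "'a measure \<Rightarrow> nat \<Rightarrow> ((nat \<Rightarrow> real) \<Rightarrow> 'a \<Rightarrow> ereal) \<Rightarrow> bool" where
  "AE_normal_integrand M k g \<longleftrightarrow>
     (\<exists>g'. normal_integrand M k g' \<and> (AE \<omega> in M. \<forall>x\<in>Rn k. g x \<omega> = g' x \<omega>))"

definition integrably_bounded_below :: "'a measure \<Rightarrow> nat \<Rightarrow> ((nat \<Rightarrow> real) \<Rightarrow> 'a \<Rightarrow> ereal) \<Rightarrow> bool" where
  "integrably_bounded_below M k g \<longleftrightarrow>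
     (\<exists>m. integrable M m \<and> (AE \<omega> in M. \<forall>x\<in>Rn k. ereal (m \<omega>) \<le> g x \<omega>))"

definition horizon :: "nat \<Rightarrow> ((nat \<Rightarrow> real) \<Rightarrow> ereal) \<Rightarrow> (nat \<Rightarrow> real) \<Rightarrow> ereal" where
  "horizon k g w =
     Lim (at_right 0) (\<lambda>\<delta>::real. INF (l, w') \<in> {0<..<\<delta>} \<times> cball_Rn k w \<delta>. ereal l * g (\<lambda>i. w' i / l))"


section \<open>Extended real-valued expectations\<close>

text \<open>Both operators are used for functions with an integrable lower bound, for which the
  subtracted term is (almost surely) finite. Note that \<open>e2ennreal\<close> maps negative numbers to 0.\<close>

definition expect :: "'a measure \<Rightarrow> ('a \<Rightarrow> ereal) \<Rightarrow> ereal" where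
  "expect M f =
     enn2ereal (\<integral>\<^sup>+\<omega>. e2ennreal (f \<omega>) \<partial>M) - enn2ereal (\<integral>\<^sup>+\<omega>. e2ennreal (- f \<omega>) \<partial>M)"

definition ereal_cond_exp :: "'a measure \<Rightarrow> 'a measure \<Rightarrow> ('a \<Rightarrow> ereal) \<Rightarrow> 'a \<Rightarrow> ereal" where
  "ereal_cond_exp M G f =
     (\<lambda>\<omega>. enn2ereal (nn_cond_exp M G (\<lambda>\<omega>. e2ennreal (f \<omega>)) \<omega>)
         - enn2ereal (nn_cond_exp M G (\<lambda>\<omega>. e2ennreal (- f \<omega>)) \<omega>))"

definition is_cond_integrand ::
  "'a measure \<Rightarrow> 'a measure \<Rightarrow> nat \<Rightarrow> ((nat \<Rightarrow> real) \<Rightarrow> 'a \<Rightarrow> ereal) \<Rightarrow> ((nat \<Rightarrow> real) \<Rightarrow> 'a \<Rightarrow> ereal) \<Rightarrow> bool"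
where
  "is_cond_integrand M G k g f \<longleftrightarrow>
     normal_integrand G k f \<and>
     (\<forall>x \<in> measurable G (borel_Rn k).
        AE \<omega> in M. f (x \<omega>) \<omega> = ereal_cond_exp M G (\<lambda>\<omega>. g (x \<omega>) \<omega>) \<omega>)"

text \<open>A conditional integrand is only determined up to a null set; an arbitrary version is chosen.\<close>

definition cond_integrand ::
  "'a measure \<Rightarrow> 'a measure \<Rightarrow> nat \<Rightarrow> ((nat \<Rightarrow> real) \<Rightarrow> 'a \<Rightarrow> ereal) \<Rightarrow> (nat \<Rightarrow> real) \<Rightarrow> 'a \<Rightarrow> ereal"
where
  "cond_integrand M G k g = (SOME f. is_cond_integrand M G k g f)"


section \<open>The stochastic optimization problem\<close>

definition complete_filtered_prob_space :: "'a measure \<Rightarrow> (nat \<Rightarrow> 'a measure) \<Rightarrow> nat \<Rightarrow> bool" where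
  "complete_filtered_prob_space M F T \<longleftrightarrow>
     prob_space M \<and> complete_measure M \<and>
     (\<forall>t\<le>T. subalgebra M (F t)) \<and>
     (\<forall>s t. s \<le> t \<and> t \<le> T \<longrightarrow> subalgebra (F t) (F s)) \<and>
     null_sets M \<subseteq> sets (F 0)"

text \<open>Adapted strategies; the components x t with t > T are irrelevant.\<close>

definition adapted :: "(nat \<Rightarrow> 'a measure) \<Rightarrow> (nat \<Rightarrow> nat) \<Rightarrow> nat \<Rightarrow> (nat \<Rightarrow> 'a \<Rightarrow> nat \<Rightarrow> real) set" where
  "adapted F n T = {x. \<forall>t\<le>T. x t \<in> measurable (F t) (borel_Rn (n t))}"

definition inf_P ::
  "'a measure \<Rightarrow> (nat \<Rightarrow> 'a measure) \<Rightarrow> (nat \<Rightarrow> nat) \<Rightarrow> nat \<Rightarrow> ((nat \<Rightarrow> real) \<Rightarrow> 'a \<Rightarrow> ereal) \<Rightarrow> ereal"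
where
  "inf_P M F n T h = (INF x \<in> adapted F n T. expect M (\<lambda>\<omega>. h (hist n x (Suc T) \<omega>) \<omega>))"

definition optimal ::
  "'a measure \<Rightarrow> (nat \<Rightarrow> 'a measure) \<Rightarrow> (nat \<Rightarrow> nat) \<Rightarrow> nat \<Rightarrow> ((nat \<Rightarrow> real) \<Rightarrow> 'a \<Rightarrow> ereal) \<Rightarrow>
     (nat \<Rightarrow> 'a \<Rightarrow> nat \<Rightarrow> real) \<Rightarrow> bool"
where
  "optimal M F n T h x \<longleftrightarrow>
     x \<in> adapted F n T \<and> expect M (\<lambda>\<omega>. h (hist n x (Suc T) \<omega>) \<omega>) = inf_P M F n T h"

function htilde ::
  "'a measure \<Rightarrow> (nat \<Rightarrow> 'a measure) \<Rightarrow> (nat \<Rightarrow> nat) \<Rightarrow> nat \<Rightarrow> ((nat \<Rightarrow> real) \<Rightarrow> 'a \<Rightarrow> ereal) \<Rightarrow>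
     nat \<Rightarrow> (nat \<Rightarrow> real) \<Rightarrow> 'a \<Rightarrow> ereal"
where
  "htilde M F n T h t =
     (if T \<le> t then h
      else (\<lambda>u \<omega>. INF v \<in> Rn (n (Suc t)).
              cond_integrand M (F (Suc t)) (total_dim n (Suc (Suc t))) (htilde M F n T h (Suc t))
                (cat (total_dim n (Suc t)) u v) \<omega>))"
  by pat_completeness auto
termination
  by (relation "Wellfounded.measure (\<lambda>(M, F, n, T, h, t). T - t)") auto

declare htilde.simps [simp del]

definition hcond ::
  "'a measure \<Rightarrow> (nat \<Rightarrow> 'a measure) \<Rightarrow> (nat \<Rightarrow> nat) \<Rightarrow> nat \<Rightarrow> ((nat \<Rightarrow> real) \<Rightarrow> 'a \<Rightarrow> ereal) \<Rightarrow>
     nat \<Rightarrow> (nat \<Rightarrow> real) \<Rightarrow> 'a \<Rightarrow> ereal"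
where
  "hcond M F n T h t = cond_integrand M (F t) (total_dim n (Suc t)) (htilde M F n T h t)"

lemma htilde_T: "htilde M F n T h T = h"
  by (simp add: htilde.simps)

lemma htilde_step:
  "t < T \<Longrightarrow> htilde M F n T h t u \<omega> =
     (INF v \<in> Rn (n (Suc t)). hcond M F n T h (Suc t) (cat (total_dim n (Suc t)) u v) \<omega>)"
  by (simp add: htilde.simps[of M F n T h t] hcond_def)

definition well_defined ::
  "'a measure \<Rightarrow> (nat \<Rightarrow> 'a measure) \<Rightarrow> (nat \<Rightarrow> nat) \<Rightarrow> nat \<Rightarrow> ((nat \<Rightarrow> real) \<Rightarrow> 'a \<Rightarrow> ereal) \<Rightarrow> nat \<Rightarrow> bool"
where
  "well_defined M F n T h t \<longleftrightarrow>
     (\<forall>s\<in>{t..T}.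
        AE_normal_integrand M (total_dim n (Suc s)) (htilde M F n T h s) \<and>
        integrably_bounded_below M (total_dim n (Suc s)) (htilde M F n T h s) \<and>
        (\<exists>f. is_cond_integrand M (F s) (total_dim n (Suc s)) (htilde M F n T h s) f))"

definition argmin_condition ::
  "'a measure \<Rightarrow> (nat \<Rightarrow> 'a measure) \<Rightarrow> (nat \<Rightarrow> nat) \<Rightarrow> nat \<Rightarrow> ((nat \<Rightarrow> real) \<Rightarrow> 'a \<Rightarrow> ereal) \<Rightarrow>
     (nat \<Rightarrow> 'a \<Rightarrow> nat \<Rightarrow> real) \<Rightarrow> bool"
where
  "argmin_condition M F n T h x \<longleftrightarrow>
     (\<forall>t\<le>T. AE \<omega> in M.
        is_arg_min (\<lambda>v. hcond M F n T h t (cat (total_dim n t) (hist n x t \<omega>) v) \<omega>) (\<lambda>v. v \<in> Rn (n t)) (x t \<omega>))"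

end

theory Submission
  imports Defs
begin

text \<open>Let \<open>V t x\<close> be the expectation of \<open>hcond t\<close> along the first blocks 0, ..., t of a strategy x. By
  the tower property it is also the expectation of \<open>htilde t\<close>, and \<open>htilde t\<close> at these blocks is at most
  \<open>hcond (t + 1)\<close> at the blocks 0, ..., t + 1, with equality iff the block t + 1 is a minimizer. Hence
  \<open>V t x\<close> increases with t from at least the expectation of the infimum of \<open>hcond 0\<close> up to
  the objective value of x, and all of these numbers agree for a strategy that minimizes at every stage.
  The horizon condition makes \<open>hcond t\<close> level-bounded in the last block, locally uniformly in the
  previous ones, so that the partial infimum is attained and lower semicontinuous.

  Measurability of partial infima and the existence of measurable minimizers rest on the measurable
  projection theorem. It follows from Choquet's capacitability theorem: over a compact set K, every set in the
  product sigma-algebra is obtained from finite unions of rectangles by the Souslin operation, and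
  the outer measure of the projection is a capacity.\<close>

section \<open>Measurable projection\<close>

text \<open>The probability space carries no topology, so conditional integrands cannot be obtained
  from regular conditional distributions. What is available is completeness: every
  \<open>F t\<close> contains all null sets, hence the restriction of \<open>M\<close> to
  \<open>F t\<close> is complete again, and the projection theorem for it keeps infima and
  minimizers adapted. The recurring obstacle is that a conditional expectation is fixed only up to a
  null set that depends on the inserted point, and there are uncountably many points. Two devices
  deal with it. Integrands are rebuilt from countably many functions on the probability space, one
  for each finite intersection of basic open sets. An inequality for all points at once is reduced
  to a single measurable selection of a violating point. Since the horizon condition holds only
  almost surely, the recursion yields functions that are normal off a null set. Passing from equal
  expectations back to minimizers requires a finite value, because an infinite expectation does not
  determine the integrand among larger ones.\<close>

locale complete_finite_measure = complete_measure M + finite_measure M for M :: "'a measure"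

text \<open>The paving for the capacity argument: it is stable under finite unions and
  intersections, and over a compact \<open>K\<close> its members have compact sections and
  measurable projections. The second factor enters through its sigma-algebra alone; compactness
  comes from the first.\<close>

inductive_set rect_unions :: "'b::topological_space set \<Rightarrow> 'a measure \<Rightarrow> ('b \<times> 'a) set set"
  for K M where
  rect: "closed C \<Longrightarrow> B \<in> sets M \<Longrightarrow> (K \<inter> C) \<times> B \<in> rect_unions K M"
| Un: "X \<in> rect_unions K M \<Longrightarrow> Y \<in> rect_unions K M \<Longrightarrow> X \<union> Y \<in> rect_unions K M"

lemma rect_unions_empty: "{} \<in> rect_unions K M"
  using rect_unions.rect[of "{}" "{}" M K] by simp

lemma rect_unions_whole: "K \<times> space M \<in> rect_unions K M"
  using rect_unions.rect[of UNIV "space M" M K] by simp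

lemma rect_unions_subset: "X \<in> rect_unions K M \<Longrightarrow> X \<subseteq> K \<times> space M"
  by (induction rule: rect_unions.induct) (auto dest: sets.sets_into_space)

lemma rect_unions_Int:
  assumes "X \<in> rect_unions K M" "Y \<in> rect_unions K M"
  shows "X \<inter> Y \<in> rect_unions K M"
  using assms(1)
proof (induction rule: rect_unions.induct)
  case (rect C B)
  show ?case using assms(2)
  proof (induction rule: rect_unions.induct)
    case (rect C' B')
    have "((K \<inter> C) \<times> B) \<inter> ((K \<inter> C') \<times> B') = (K \<inter> (C \<inter> C')) \<times> (B \<inter> B')" by auto
    then show ?case
      using rect_unions.rect[of "C \<inter> C'" "B \<inter> B'" M K] rect \<open>closed C\<close> \<open>B \<in> sets M\<close> by auto
  qed (auto simp: Int_Un_distrib intro: rect_unions.Un)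
qed (auto simp: Int_Un_distrib2 intro: rect_unions.Un)

lemma rect_unions_Union: "finite \<X> \<Longrightarrow> \<X> \<subseteq> rect_unions K M \<Longrightarrow> \<Union>\<X> \<in> rect_unions K M"
  by (induction rule: finite_induct) (auto intro: rect_unions.Un rect_unions_empty)

lemma rect_unions_INT_atMost: "(\<And>n. X n \<in> rect_unions K M) \<Longrightarrow> (\<Inter>n\<le>N::nat. X n) \<in> rect_unions K M"
proof (induction N)
  case (Suc N)
  then have "(\<Inter>n\<le>N. X n) \<inter> X (Suc N) \<in> rect_unions K M" by (intro rect_unions_Int) auto
  then show ?case by (simp add: atMost_Suc Int_commute)
qed auto

lemma rect_unions_proj: "X \<in> rect_unions K M \<Longrightarrow> snd ` X \<in> sets M"
proof (induction rule: rect_unions.induct)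
  case (rect C B)
  then show ?case by (cases "K \<inter> C = {}") (auto simp: snd_image_times)
qed (auto simp: image_Un)

lemma rect_unions_section:
  fixes K :: "'b::t2_space set"
  assumes "compact K"
  shows "X \<in> rect_unions K M \<Longrightarrow> compact {x. (x, w) \<in> X}"
proof (induction rule: rect_unions.induct)
  case (rect C B)
  have "{x. (x, w) \<in> (K \<inter> C) \<times> B} = (if w \<in> B then K \<inter> C else {})" by auto
  then show ?case using rect assms by (auto intro: compact_Int_closed)
next
  case (Un X Y)
  have "{x. (x, w) \<in> X \<union> Y} = {x. (x, w) \<in> X} \<union> {x. (x, w) \<in> Y}" by auto
  then show ?case using Un by (auto intro: compact_Un)
qed

lemma rect_unions_sets:
  fixes K :: "'b::t2_space set"
  assumes "compact K"
  shows "X \<in> rect_unions K M \<Longrightarrow> X \<in> sets (borel \<Otimes>\<^sub>M M)"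
proof (induction rule: rect_unions.induct)
  case (rect C B)
  then show ?case using compact_imp_closed[OF assms] by (intro pair_measureI) auto
qed auto

text \<open>Sets from which a measurable point can be selected section by section. Measurability of
  the projection is part of the definition because the capacity argument supplies it directly,
  before the projection theorem is available.\<close>

definition compact_meas :: "'a measure \<Rightarrow> ('b::t2_space \<times> 'a) set \<Rightarrow> bool" where
  "compact_meas M D \<longleftrightarrow>
     D \<in> sets (borel \<Otimes>\<^sub>M M) \<and> (\<forall>w. compact {x. (x, w) \<in> D}) \<and> snd ` D \<in> sets M"

text \<open>Over a fixed \<open>w\<close> the sections are nested nonempty compact sets and have a
  common point by the finite intersection property. This gives continuity of the capacity along
  decreasing sequences, and later shows that the lexicographic selection ends in a point.\<close>

lemma proj_decseq_INT:
  fixes D :: "nat \<Rightarrow> ('b::t2_space \<times> 'a) set"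
  assumes "\<And>N w. compact {x. (x, w) \<in> D N}" "decseq D"
  shows "snd ` (\<Inter>N. D N) = (\<Inter>N. snd ` D N)"
proof
  show "(\<Inter>N. snd ` D N) \<subseteq> snd ` (\<Inter>N. D N)"
  proof
    fix w assume w: "w \<in> (\<Inter>N. snd ` D N)"
    define S where "S N = {x. (x, w) \<in> D N}" for N
    have ne: "S N \<noteq> {}" for N using w by (force simp: S_def)
    have "S 0 \<inter> (\<Inter>N\<in>UNIV. S N) \<noteq> {}"
    proof (rule compact_imp_fip_image)
      show "compact (S 0)" "\<And>N. closed (S N)"
        using assms(1) by (auto simp: S_def intro: compact_imp_closed)
      fix I :: "nat set" assume "finite I"
      then have "n \<le> Max (insert 0 I)" if "n \<in> insert 0 I" for n using that by (intro Max_ge) auto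
      then have "S (Max (insert 0 I)) \<subseteq> S n" if "n \<in> insert 0 I" for n
        using decseqD[OF \<open>decseq D\<close>, of n "Max (insert 0 I)"] that by (auto simp: S_def)
      then have "S (Max (insert 0 I)) \<subseteq> S 0 \<inter> (\<Inter>N\<in>I. S N)" by blast
      with ne show "S 0 \<inter> (\<Inter>N\<in>I. S N) \<noteq> {}" by blast
    qed
    then obtain x where "\<And>N. x \<in> S N" by auto
    then show "w \<in> snd ` (\<Inter>N. D N)" by (force simp: S_def)
  qed
qed auto

lemma compact_meas_decseq_INT:
  fixes K :: "'b::t2_space set"
  assumes K: "compact K" and D: "\<And>N. D N \<in> rect_unions K M" and "decseq D"
  shows "compact_meas M (\<Inter>N. D N)" "snd ` (\<Inter>N. D N) = (\<Inter>N. snd ` D N)"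
proof -
  note c = rect_unions_section[OF K D]
  show *: "snd ` (\<Inter>N. D N) = (\<Inter>N. snd ` D N)"
    by (rule proj_decseq_INT[OF c \<open>decseq D\<close>])
  have "compact {x. (x, w) \<in> (\<Inter>N. D N)}" for w
  proof -
    have "{x. (x, w) \<in> (\<Inter>N. D N)} = {x. (x, w) \<in> D 0} \<inter> (\<Inter>N. {x. (x, w) \<in> D N})" by auto
    moreover have "compact ({x. (x, w) \<in> D 0} \<inter> (\<Inter>N. {x. (x, w) \<in> D N}))"
      by (intro compact_Int_closed closed_INT ballI compact_imp_closed c)
    ultimately show ?thesis by simp
  qed
  moreover have "(\<Inter>N. D N) \<in> sets (borel \<Otimes>\<^sub>M M)"
    using rect_unions_sets[OF K D] by (intro sets.countable_INT) auto
  moreover have "(\<Inter>N. snd ` D N) \<in> sets M"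
    using rect_unions_proj[OF D] by (intro sets.countable_INT) auto
  ultimately show "compact_meas M (\<Inter>N. D N)" by (simp add: compact_meas_def *)
qed

section \<open>The Souslin operation\<close>

definition souslin_scheme ::
  "'b::topological_space set \<Rightarrow> 'a measure \<Rightarrow> (nat \<Rightarrow> (nat \<Rightarrow> nat) \<Rightarrow> ('b \<times> 'a) set) \<Rightarrow> bool" where
  "souslin_scheme K M S \<longleftrightarrow> (\<forall>n f. S n f \<in> rect_unions K M) \<and>
     (\<forall>n. \<exists>r. \<forall>f g. (\<forall>i<r. f i = g i) \<longrightarrow> S n f = S n g)"

text \<open>Branches are whole sequences, and the set at level \<open>n\<close> may look at any
  finite number of coordinates, without monotonicity in \<open>n\<close>. Compared with indexing by
  finite words this leaves the freedom to recode branches, on which the closure properties below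
  rest.\<close>

definition souslin :: "'b::topological_space set \<Rightarrow> 'a measure \<Rightarrow> ('b \<times> 'a) set \<Rightarrow> bool" where
  "souslin K M A \<longleftrightarrow> (\<exists>S. souslin_scheme K M S \<and> A = (\<Union>f. \<Inter>n. S n f))"

lemma souslin_rect: "X \<in> rect_unions K M \<Longrightarrow> souslin K M X"
  unfolding souslin_def souslin_scheme_def by (rule exI[of _ "\<lambda>_ _. X"]) auto

text \<open>One sequence \<open>g\<close> stores a branch for every \<open>i\<close>: row
  \<open>i\<close> is read at the positions \<open>prod_encode (i, j)\<close>. The level
  \<open>N\<close> codes a pair of a set number and a level of its scheme, so that all conditions
  are imposed simultaneously.\<close>

lemma souslin_INT:
  assumes "\<And>i::nat. souslin K M (A i)"
  shows "souslin K M (\<Inter>i. A i)"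
proof -
  obtain S where SS: "\<And>i. souslin_scheme K M (S i)" and A: "\<And>i. A i = (\<Union>f. \<Inter>n. S i n f)"
    using assms unfolding souslin_def by metis
  have S: "S i n f \<in> rect_unions K M" for i n f using SS by (simp add: souslin_scheme_def)
  have dep: "\<exists>r. \<forall>f g. (\<forall>j<r. f j = g j) \<longrightarrow> S i n f = S i n g" for i n
    using SS by (simp add: souslin_scheme_def)
  define S' where "S' N g = S (fst (prod_decode N)) (snd (prod_decode N))
      (\<lambda>j. g (prod_encode (fst (prod_decode N), j)))" for N g
  show ?thesis unfolding souslin_def souslin_scheme_def
  proof (intro exI[of _ S'] conjI allI)
    show "S' N g \<in> rect_unions K M" for N g by (simp add: S'_def S)
    show "\<exists>r. \<forall>f g. (\<forall>i<r. f i = g i) \<longrightarrow> S' N f = S' N g" for N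
    proof -
      obtain i n where N: "prod_decode N = (i, n)" by (cases "prod_decode N")
      obtain r where r: "\<And>f g. (\<forall>j<r. f j = g j) \<Longrightarrow> S i n f = S i n g" using dep by blast
      \<comment> \<open>The first \<open>r\<close> entries of row \<open>i\<close> may sit at
        positions far beyond \<open>r\<close>; the sum bounds all of these positions.\<close>
      define r' where "r' = Suc (\<Sum>j<r. prod_encode (i, j))"
      have "prod_encode (i, j) < r'" if "j < r" for j
        using member_le_sum[of j "{..<r}" "\<lambda>j. prod_encode (i, j)"] that by (simp add: r'_def)
      then show ?thesis
        unfolding S'_def N fst_conv snd_conv by (intro exI[of _ r'] allI impI r) auto
    qed
    show "(\<Inter>i. A i) = (\<Union>g. \<Inter>N. S' N g)"
    proof (intro equalityI subsetI)
      fix p assume "p \<in> (\<Inter>i. A i)"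
      then have "\<forall>i. \<exists>f. \<forall>n. p \<in> S i n f" by (auto simp: A)
      then obtain f where f: "\<And>i n. p \<in> S i n (f i)" by metis
      have "p \<in> S' N (\<lambda>k. f (fst (prod_decode k)) (snd (prod_decode k)))" for N
        using f by (simp add: S'_def)
      then show "p \<in> (\<Union>g. \<Inter>N. S' N g)" by blast
    next
      fix p assume "p \<in> (\<Union>g. \<Inter>N. S' N g)"
      then obtain g where g: "\<And>N. p \<in> S' N g" by blast
      have "p \<in> S i n (\<lambda>j. g (prod_encode (i, j)))" for i n
        using g[of "prod_encode (i, n)"] by (simp add: S'_def)
      then show "p \<in> (\<Inter>i. A i)" by (auto simp: A)
    qed
  qed
qed

text \<open>The entry \<open>g 0\<close> names the member of the union and the shifted sequence is a
  branch of its scheme. Levels belonging to other members are replaced by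
  \<open>K \<times> space M\<close>, which imposes no condition on points of the product.\<close>

lemma souslin_UN:
  assumes "\<And>i::nat. souslin K M (A i)"
  shows "souslin K M (\<Union>i. A i)"
proof -
  obtain S where SS: "\<And>i. souslin_scheme K M (S i)" and A: "\<And>i. A i = (\<Union>f. \<Inter>n. S i n f)"
    using assms unfolding souslin_def by metis
  have S: "S i n f \<in> rect_unions K M" for i n f using SS by (simp add: souslin_scheme_def)
  have dep: "\<exists>r. \<forall>f g. (\<forall>j<r. f j = g j) \<longrightarrow> S i n f = S i n g" for i n
    using SS by (simp add: souslin_scheme_def)
  define S' where "S' N g = (if g 0 = fst (prod_decode N)
      then S (g 0) (snd (prod_decode N)) (\<lambda>j. g (Suc j)) else K \<times> space M)" for N g
  show ?thesis unfolding souslin_def souslin_scheme_def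
  proof (intro exI[of _ S'] conjI allI)
    show "S' N g \<in> rect_unions K M" for N g by (simp add: S'_def S rect_unions_whole)
    show "\<exists>r. \<forall>f g. (\<forall>i<r. f i = g i) \<longrightarrow> S' N f = S' N g" for N
    proof -
      obtain i n where N: "prod_decode N = (i, n)" by (cases "prod_decode N")
      obtain r where r: "\<And>f g. (\<forall>j<r. f j = g j) \<Longrightarrow> S i n f = S i n g" using dep by blast
      have "S i n (\<lambda>j. f (Suc j)) = S i n (\<lambda>j. g (Suc j))" if "\<forall>k<Suc r. f k = g k" for f g
        using that by (intro r) auto
      then show ?thesis unfolding S'_def N fst_conv snd_conv by (intro exI[of _ "Suc r"]) auto
    qed
    show "(\<Union>i. A i) = (\<Union>g. \<Inter>N. S' N g)"
    proof (intro equalityI subsetI)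
      fix p assume "p \<in> (\<Union>i. A i)"
      then obtain i f where f: "\<And>n. p \<in> S i n f" by (auto simp: A)
      then have "p \<in> K \<times> space M" using rect_unions_subset[OF S] by blast
      then have "p \<in> S' N (case_nat i f)" for N using f by (auto simp: S'_def)
      then show "p \<in> (\<Union>g. \<Inter>N. S' N g)" by blast
    next
      fix p assume "p \<in> (\<Union>g. \<Inter>N. S' N g)"
      then obtain g where g: "\<And>N. p \<in> S' N g" by blast
      have "p \<in> S (g 0) n (\<lambda>j. g (Suc j))" for n
        using g[of "prod_encode (g 0, n)"] by (simp add: S'_def)
      then show "p \<in> (\<Union>i. A i)" by (auto simp: A)
    qed
  qed
qed

lemma souslin_Un:
  assumes "souslin K M A" "souslin K M B" shows "souslin K M (A \<union> B)"
proof -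
  have "souslin K M (\<Union>i. if i = (0::nat) then A else B)" using assms by (intro souslin_UN) auto
  also have "(\<Union>i. if i = (0::nat) then A else B) = A \<union> B" by (auto split: if_splits)
  finally show ?thesis .
qed

lemma souslin_Int:
  assumes "souslin K M A" "souslin K M B" shows "souslin K M (A \<inter> B)"
proof -
  have "souslin K M (\<Inter>i. if i = (0::nat) then A else B)" using assms by (intro souslin_INT) auto
  also have "(\<Inter>i. if i = (0::nat) then A else B) = A \<inter> B" by (auto split: if_splits)
  finally show ?thesis .
qed

text \<open>The Souslin operation does not preserve complements. Tracking a set together with its
  complement in \<open>K \<times> space M\<close> turns closure under countable unions and
  intersections into an induction over the generated sigma-algebra.\<close>

definition bisouslin :: "'b::topological_space set \<Rightarrow> 'a measure \<Rightarrow> ('b \<times> 'a) set \<Rightarrow> bool" where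
  "bisouslin K M A \<longleftrightarrow> souslin K M (A \<inter> K \<times> space M) \<and> souslin K M (K \<times> space M - A)"

lemma bisouslin_UN:
  assumes "\<And>i::nat. bisouslin K M (A i)" shows "bisouslin K M (\<Union>i. A i)"
proof -
  have eq: "(\<Union>i. A i) \<inter> K \<times> space M = (\<Union>i. A i \<inter> K \<times> space M)"
    "K \<times> space M - (\<Union>i. A i) = (\<Inter>i. K \<times> space M - A i)" by auto
  show ?thesis
    unfolding bisouslin_def eq using assms by (intro conjI souslin_UN souslin_INT) (auto simp: bisouslin_def)
qed

text \<open>In a metric space the complement of a closed set is a countable union of closed sets;
  this is where the metric enters.\<close>

lemma bisouslin_closed_times:
  fixes K :: "'b::metric_space set"
  assumes C: "closed C" and B: "B \<in> sets M"
  shows "bisouslin K M (C \<times> B)"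
proof -
  have "fsigma_in euclidean (- C)"
    using C by (intro open_imp_fsigma_in) (auto simp: metrizable_space_euclidean)
  then obtain X where X: "countable X" "\<And>x. x \<in> X \<Longrightarrow> closed x" "- C = \<Union>X"
    unfolding fsigma_in_def union_of_def closed_closedin by (auto simp: subset_iff)
  \<comment> \<open>\<open>X\<close> may be empty, while \<open>from_nat_into\<close> has the right
    range only for nonempty sets; inserting the empty set does not change the union.\<close>
  define E where "E = from_nat_into (insert {} X)"
  have rE: "range E = insert {} X" unfolding E_def by (rule range_from_nat_into) (use X in auto)
  then have "- C = (\<Union>i. E i)" using X by auto
  moreover have "closed (E i)" for i using rE X(2) by (metis closed_empty insertE rangeI)
  moreover have "K \<times> space M - C \<times> B = K \<times> (space M - B) \<union> (K \<inter> - C) \<times> space M"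
    using sets.sets_into_space[OF B] by auto
  ultimately have eq: "K \<times> space M - C \<times> B =
      (K \<inter> UNIV) \<times> (space M - B) \<union> (\<Union>i. (K \<inter> E i) \<times> space M)" by auto
  have "souslin K M (K \<times> space M - C \<times> B)"
    unfolding eq using B \<open>\<And>i. closed (E i)\<close>
    by (intro souslin_Un souslin_UN souslin_rect rect_unions.rect) auto
  moreover have "(C \<times> B) \<inter> K \<times> space M = (K \<inter> C) \<times> B" using sets.sets_into_space[OF B] by auto
  ultimately show ?thesis using assms by (auto simp: bisouslin_def intro!: souslin_rect rect_unions.rect)
qed

lemma bisouslin_borel_times:
  fixes K :: "'b::metric_space set"
  assumes "a \<in> sets borel" and B: "B \<in> sets M"
  shows "bisouslin K M (a \<times> B)"
proof -
  have "a \<in> sigma_sets UNIV (Collect closed)" using assms(1) by (simp add: borel_eq_closed)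
  then show ?thesis
  proof induction
    case (Compl a)
    have "(UNIV - a) \<times> B \<inter> K \<times> space M = (K \<times> space M - a \<times> B) \<inter> (UNIV \<times> B \<inter> K \<times> space M)"
      "K \<times> space M - (UNIV - a) \<times> B = (a \<times> B \<inter> K \<times> space M) \<union> (K \<times> space M - UNIV \<times> B)"
      by auto
    then show ?case using Compl bisouslin_closed_times[of UNIV B M K] B
      by (auto simp: bisouslin_def intro!: souslin_Int souslin_Un)
  next
    case (Union a)
    have "(\<Union>i. a i) \<times> B = (\<Union>i. a i \<times> B)" by auto
    then show ?case using Union by (auto intro: bisouslin_UN)
  next
    case Empty
    show ?case using bisouslin_closed_times[OF closed_empty B] by simp
  qed (use bisouslin_closed_times[OF _ B] in simp)
qed

lemma souslin_sets:
  fixes K :: "'b::metric_space set"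
  assumes "A \<in> sets (borel \<Otimes>\<^sub>M M)" "A \<subseteq> K \<times> space M"
  shows "souslin K M A"
proof -
  have "A \<in> sigma_sets (UNIV \<times> space M) {a \<times> b |a b. a \<in> sets borel \<and> b \<in> sets M}"
    using assms(1) by (simp add: sets_pair_measure)
  then have "bisouslin K M A"
  proof induction
    case (Basic A) then show ?case using bisouslin_borel_times by auto
  next
    case Empty
    then show ?case using bisouslin_closed_times[of "{}" "{}" M K] by simp
  next
    case (Compl A)
    have "(UNIV \<times> space M - A) \<inter> K \<times> space M = K \<times> space M - A"
      "K \<times> space M - (UNIV \<times> space M - A) = A \<inter> K \<times> space M" by auto
    then show ?case using Compl by (auto simp: bisouslin_def)
  next
    case (Union A) then show ?case by (intro bisouslin_UN)
  qed
  then show ?thesis using assms(2) by (simp add: bisouslin_def Int_absorb2)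
qed

section \<open>Compactness in the space of branches, and capacitability\<close>

lemma closed_finitely_determined:
  fixes P :: "(nat \<Rightarrow> nat) \<Rightarrow> bool"
  assumes r: "\<And>f g. (\<forall>i<r. f i = g i) \<Longrightarrow> P f = P g"
  shows "closed {f. P f}"
proof -
  have "open {f. \<not> P f}"
  proof (subst open_subopen, safe)
    fix f assume f: "\<not> P f"
    have "open (\<Inter>i\<in>{..<r}. (\<lambda>g. g i) -` {f i})"
      by (intro open_INT ballI open_vimage) (auto intro: discrete_topology_class.open_discrete continuous_on_product_coordinates)
    moreover have "(\<Inter>i\<in>{..<r}. (\<lambda>g. g i) -` {f i}) \<subseteq> {f. \<not> P f}"
    proof
      fix g assume "g \<in> (\<Inter>i\<in>{..<r}. (\<lambda>g. g i) -` {f i})"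
      then have "P g = P f" by (intro r) auto
      then show "g \<in> {f. \<not> P f}" using f by simp
    qed
    ultimately show "\<exists>T. open T \<and> f \<in> T \<and> T \<subseteq> {f. \<not> P f}"
      by (intro exI[of _ "\<Inter>i\<in>{..<r}. (\<lambda>g. g i) -` {f i}"]) auto
  qed
  then show ?thesis by (simp add: closed_def Compl_eq)
qed

lemma compact_bounded_seqs: "compact {f :: nat \<Rightarrow> nat. \<forall>i. f i \<le> m i}"
proof -
  have "compactin (product_topology (\<lambda>_. euclidean) UNIV) (PiE UNIV (\<lambda>i. {..m i}))"
    unfolding compactin_PiE by (auto simp: finite_imp_compact)
  moreover have "PiE UNIV (\<lambda>i. {..m i}) = {f :: nat \<Rightarrow> nat. \<forall>i. f i \<le> m i}" by auto
  ultimately show ?thesis by (simp add: euclidean_product_topology)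
qed

text \<open>Choquet's capacitability theorem for the capacity that maps a subset of the product to the
  outer measure of its projection.\<close>

lemma (in finite_measure) souslin_capacity:
  fixes K :: "'b::t2_space set"
  assumes K: "compact K" and "souslin K M A" and c: "c < outer_measure_of M (snd ` A)"
  shows "\<exists>D\<subseteq>A. compact_meas M D \<and> c \<le> emeasure M (snd ` D)"
proof -
  obtain S where SS: "souslin_scheme K M S" and A: "A = (\<Union>f. \<Inter>n. S n f)"
    using assms(2) unfolding souslin_def by blast
  have S: "S n f \<in> rect_unions K M" for n f using SS by (simp add: souslin_scheme_def)
  have "\<forall>n. \<exists>r. \<forall>f g. (\<forall>i<r. f i = g i) \<longrightarrow> S n f = S n g"
    using SS by (simp add: souslin_scheme_def)
  from choice[OF this] obtain r where r: "\<And>n f g. (\<forall>i<r n. f i = g i) \<Longrightarrow> S n f = S n g" by blast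
  \<comment> \<open>The part of \<open>A\<close> that is reached by branches whose first
    \<open>N\<close> entries are bounded by \<open>m\<close>.\<close>
  define AN where "AN N m = (\<Union>f\<in>{f. \<forall>i<N. f i \<le> m i}. \<Inter>n. S n f)" for N and m :: "nat \<Rightarrow> nat"
  have AN_space: "snd ` AN N m \<subseteq> space M" for N m
    using rect_unions_subset[OF S] unfolding AN_def by fastforce
  \<comment> \<open>The bounds are fixed one coordinate at a time. Relaxing the bound on the next
    coordinate exhausts \<open>AN N m\<close>, and outer measure is continuous along increasing
    sequences of arbitrary sets, so some finite bound keeps the value above
    \<open>c\<close>.\<close>
  have "\<exists>mm. \<forall>N. c < outer_measure_of M (snd ` AN N (mm N)) \<and> (\<exists>k. mm (Suc N) = (mm N)(N := k))"
  proof (rule dependent_nat_choice)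
    show "\<exists>m. c < outer_measure_of M (snd ` AN 0 m)" using c by (auto simp: AN_def A)
  next
    fix m N assume m: "c < outer_measure_of M (snd ` AN N m)"
    let ?B = "\<lambda>k. snd ` AN (Suc N) (m(N := k))"
    have "incseq ?B"
      unfolding AN_def by (intro monoI image_mono UN_mono) (auto simp: less_Suc_eq split: if_splits)
    then have "(SUP k. outer_measure_of M (?B k)) = outer_measure_of M (\<Union>k. ?B k)"
      by (intro SUP_outer_measure_of_incseq AN_space)
    also have "AN N m \<subseteq> (\<Union>k. AN (Suc N) (m(N := k)))"
    proof
      fix p assume "p \<in> AN N m"
      then obtain f where "\<forall>i<N. f i \<le> m i" "p \<in> (\<Inter>n. S n f)" by (auto simp: AN_def)
      then have "p \<in> AN (Suc N) (m(N := f N))" by (auto simp: AN_def less_Suc_eq)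
      then show "p \<in> (\<Union>k. AN (Suc N) (m(N := k)))" by blast
    qed
    then have "outer_measure_of M (snd ` AN N m) \<le> outer_measure_of M (\<Union>k. ?B k)"
      by (intro outer_measure_of_mono) blast
    finally have "c < (SUP k. outer_measure_of M (?B k))"
      using m by (metis (no_types, lifting) \<open>(SUP k. outer_measure_of M (?B k)) = outer_measure_of M (\<Union>k. ?B k)\<close> order_less_le_trans)
    then obtain k where "c < outer_measure_of M (?B k)" by (auto simp: less_SUP_iff)
    then show "\<exists>m'. c < outer_measure_of M (snd ` AN (Suc N) m') \<and> (\<exists>k. m' = m(N := k))" by blast
  qed
  then obtain mm where mm: "\<And>N. c < outer_measure_of M (snd ` AN N (mm N))"
    and step: "\<And>N. \<exists>k. mm (Suc N) = (mm N)(N := k)" by blast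
  \<comment> \<open>Entry \<open>i\<close> is chosen in passing to step \<open>Suc i\<close> and
    never changed afterwards, so the diagonal agrees with \<open>mm N\<close> below
    \<open>N\<close>.\<close>
  define m where "m i = mm (Suc i) i" for i
  have stable: "mm (i + Suc d) i = m i" for i d
  proof (induction d)
    case (Suc d)
    obtain k where "mm (Suc (i + Suc d)) = (mm (i + Suc d))(i + Suc d := k)" using step by blast
    then show ?case using Suc by auto
  qed (simp add: m_def)
  have m: "mm N i = m i" if "i < N" for i N
    using stable[of i "N - Suc i"] that by simp
  have "AN N m = AN N (mm N)" for N unfolding AN_def using m by auto
  then have cm: "c < outer_measure_of M (snd ` AN N m)" for N using mm by simp

  define G where "G = {f. \<forall>i. f i \<le> m i}"
  define D where "D N = (\<Union>f\<in>G. \<Inter>n\<le>N. S n f)" for N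
  define R where "R N = (\<Sum>n\<le>N. r n)" for N
  have R: "r n \<le> R N" if "n \<le> N" for n N
    unfolding R_def using that by (intro member_le_sum) auto
  \<comment> \<open>The sets at levels up to \<open>N\<close> depend on the first \<open>R N\<close>
    entries only. Setting the remaining entries to 0 leaves finitely many bounded branches, so the
    union over the infinite set \<open>G\<close> in \<open>D N\<close> is a finite one.\<close>
  define tr where "tr N f i = (if i < R N then f i else 0)" for N and f :: "nat \<Rightarrow> nat" and i
  have S_tr: "S n (tr N f) = S n f" if "n \<le> N" for n N f
    using R[OF that] by (intro r) (auto simp: tr_def)
  have D_mem: "D N \<in> rect_unions K M" for N
  proof -
    let ?F = "{f. \<forall>i. (i \<in> {..<R N} \<longrightarrow> f i \<in> {..sum m {..<R N}}) \<and> (i \<notin> {..<R N} \<longrightarrow> f i = 0)}"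
    have "(\<lambda>f. \<Inter>n\<le>N. S n f) ` G \<subseteq> (\<lambda>f. \<Inter>n\<le>N. S n f) ` ?F"
    proof safe
      fix f assume "f \<in> G"
      have "f i \<le> sum m {..<R N}" if "i < R N" for i
        using member_le_sum[of i "{..<R N}" m] that \<open>f \<in> G\<close> by (auto simp: G_def intro: order_trans)
      then have "tr N f \<in> ?F" by (auto simp: tr_def)
      moreover have "(\<Inter>n\<le>N. S n f) = (\<Inter>n\<le>N. S n (tr N f))" using S_tr by auto
      ultimately show "(\<Inter>n\<le>N. S n f) \<in> (\<lambda>f. \<Inter>n\<le>N. S n f) ` ?F" by blast
    qed
    moreover have "finite ?F" by (rule finite_set_of_finite_funs) auto
    ultimately have "finite ((\<lambda>f. \<Inter>n\<le>N. S n f) ` G)" by (meson finite_imageI finite_subset)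
    then show ?thesis unfolding D_def
      by (rule rect_unions_Union) (auto intro: rect_unions_INT_atMost S)
  qed
  have "decseq D" unfolding D_def decseq_def by fastforce
  have AN_D: "AN (R N) m \<subseteq> D N" for N
  proof
    fix p assume "p \<in> AN (R N) m"
    then obtain f where f: "\<forall>i<R N. f i \<le> m i" "\<And>n. p \<in> S n f" by (auto simp: AN_def)
    then have "tr N f \<in> G" by (auto simp: G_def tr_def)
    moreover have "p \<in> (\<Inter>n\<le>N. S n (tr N f))" using f S_tr by auto
    ultimately show "p \<in> D N" by (auto simp: D_def)
  qed
  have "(\<Inter>N. D N) \<subseteq> A"
  proof
    fix p assume p: "p \<in> (\<Inter>N. D N)"
    \<comment> \<open>A point of all \<open>D N\<close> has, for each \<open>N\<close>, its own
      branch that works up to level \<open>N\<close>. The conditions are closed in the compact set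
      \<open>G\<close>, so a single branch satisfies all of them.\<close>
    have "G \<inter> (\<Inter>n\<in>UNIV. {f. p \<in> S n f}) \<noteq> {}"
    proof (rule compact_imp_fip_image)
      show "compact G" unfolding G_def by (rule compact_bounded_seqs)
      show "closed {f. p \<in> S n f}" for n
        using r by (intro closed_finitely_determined[of "r n"]) auto
      fix I :: "nat set" assume "finite I"
      have "p \<in> D (Max (insert 0 I))" using p by blast
      then obtain f where "f \<in> G" "\<forall>n\<le>Max (insert 0 I). p \<in> S n f" by (auto simp: D_def)
      then have "f \<in> G \<inter> (\<Inter>n\<in>I. {f. p \<in> S n f})" using \<open>finite I\<close> by auto
      then show "G \<inter> (\<Inter>n\<in>I. {f. p \<in> S n f}) \<noteq> {}" by blast
    qed
    then show "p \<in> A" by (auto simp: A)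
  qed
  moreover note cmD = compact_meas_decseq_INT[OF K D_mem \<open>decseq D\<close>]
  moreover have "c \<le> emeasure M (snd ` (\<Inter>N. D N))"
  proof -
    \<comment> \<open>The projection of \<open>D N\<close> is measurable, so the outer measure
      becomes the measure, which is continuous from above because it is finite.\<close>
    have "c \<le> emeasure M (snd ` D N)" for N
      using cm[of "R N"] outer_measure_of_mono[OF image_mono[OF AN_D], of M snd N]
        rect_unions_proj[OF D_mem] by (metis outer_measure_of_eq less_imp_le order_trans)
    then have "c \<le> (INF N. emeasure M (snd ` D N))" by (intro INF_greatest)
    also have "\<dots> = emeasure M (\<Inter>N. snd ` D N)"
      using \<open>decseq D\<close> rect_unions_proj[OF D_mem]
      by (intro INF_emeasure_decseq) (auto simp: decseq_def image_mono)
    finally show ?thesis by (simp add: cmD(2))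
  qed
  ultimately show ?thesis by blast
qed

section \<open>Inner exhaustion and the projection theorem\<close>

context complete_finite_measure
begin

text \<open>The projection has a measurable hull \<open>E\<close> of the same outer measure.
  Capacitability gives pieces with compact sections whose projections nearly fill \<open>E\<close>;
  the rest lies in a null set and is handled by completeness. Both projection and selection rest on
  this.\<close>

lemma compact_exhaustion:
  fixes K :: "'b::metric_space set"
  assumes K: "compact K" and A: "A \<in> sets (borel \<Otimes>\<^sub>M M)" "A \<subseteq> K \<times> space M"
  shows "\<exists>D. (\<forall>j::nat. D j \<subseteq> A \<and> compact_meas M (D j)) \<and> snd ` A - (\<Union>j. snd ` D j) \<in> null_sets M"
proof -
  have sp: "snd ` A \<subseteq> space M" using A(2) by auto
  obtain E where E: "E \<in> sets M" "snd ` A \<subseteq> E" "outer_measure_of M (snd ` A) = emeasure M E"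
    using outer_measure_of_attain[OF sp] by blast
  show ?thesis
  \<comment> \<open>A null hull is treated apart, since no \<open>c\<close> lies strictly below 0 to
    start the approximation.\<close>
  proof (cases "emeasure M E = 0")
    case True
    then have "E \<in> null_sets M" using E(1) by auto
    then have "snd ` A \<in> null_sets M" using E(2) complete2 by blast
    then show ?thesis by (intro exI[of _ "\<lambda>_. {}"]) (auto simp: compact_meas_def)
  next
    case False
    then have "0 < emeasure M E" by (simp add: zero_less_iff_neq_zero)
    then obtain c where c: "\<And>n. c n < emeasure M E" "c \<longlonglongrightarrow> emeasure M E"
      using approx_from_below_dense_linorder by blast
    have "\<exists>D\<subseteq>A. compact_meas M D \<and> c n \<le> emeasure M (snd ` D)" for n
      using c(1) by (intro souslin_capacity[OF K souslin_sets[OF A]]) (auto simp: E(3))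
    then obtain D where D: "\<And>n. D n \<subseteq> A" "\<And>n. compact_meas M (D n)" "\<And>n. c n \<le> emeasure M (snd ` D n)"
      by metis
    have meas: "snd ` D n \<in> sets M" for n using D(2) by (auto simp: compact_meas_def)
    let ?U = "\<Union>j. snd ` D j"
    have "c n \<le> emeasure M ?U" for n
      using D(3)[of n] emeasure_mono[of "snd ` D n" ?U M] meas by (meson UN_upper UNIV_I order_trans sets.countable_UN image_subsetI)
    then have "emeasure M E \<le> emeasure M ?U" by (intro LIMSEQ_le_const2[OF c(2)]) auto
    moreover have "?U \<subseteq> E" using D(1) E(2) by blast
    moreover have "emeasure M (E - ?U) = emeasure M E - emeasure M ?U"
      using meas \<open>?U \<subseteq> E\<close> E(1) by (intro emeasure_Diff) auto
    ultimately have "emeasure M (E - ?U) = 0"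
      by (simp add: diff_eq_0_ennreal less_top[symmetric])
    then have "E - ?U \<in> null_sets M" using E(1) meas by auto
    then have "snd ` A - ?U \<in> null_sets M" by (rule complete2[rotated]) (use E in auto)
    then show ?thesis using D by blast
  qed
qed

lemma compact_exhaustion_sigma:
  fixes K :: "nat \<Rightarrow> 'b::metric_space set"
  assumes K: "\<And>i. compact (K i)" and A: "A \<in> sets (borel \<Otimes>\<^sub>M M)" "A \<subseteq> (\<Union>i. K i) \<times> space M"
  shows "\<exists>D. (\<forall>j::nat. D j \<subseteq> A \<and> compact_meas M (D j)) \<and> snd ` A - (\<Union>j. snd ` D j) \<in> null_sets M"
proof -
  define B where "B i = A \<inter> K i \<times> space M" for i
  have "\<exists>D. (\<forall>j::nat. D j \<subseteq> B i \<and> compact_meas M (D j)) \<and> snd ` B i - (\<Union>j. snd ` D j) \<in> null_sets M" for i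
    using K A compact_imp_closed[OF K[of i]]
    by (intro compact_exhaustion[of "K i"]) (auto simp: B_def intro!: sets.Int pair_measureI)
  from choice[OF allI[OF this]] obtain D where
    Q: "\<forall>i. (\<forall>j::nat. D i j \<subseteq> B i \<and> compact_meas M (D i j)) \<and> snd ` B i - (\<Union>j. snd ` D i j) \<in> null_sets M"
    by (rule exE)
  have D: "D i j \<subseteq> B i" "compact_meas M (D i j)" "snd ` B i - (\<Union>j. snd ` D i j) \<in> null_sets M" for i j
    using spec[OF Q, of i] by simp_all
  define D' where "D' k = D (fst (prod_decode k)) (snd (prod_decode k))" for k
  have "snd ` A - (\<Union>k. snd ` D' k) \<subseteq> (\<Union>i. snd ` B i - (\<Union>j. snd ` D i j))"
  proof
    fix w assume w: "w \<in> snd ` A - (\<Union>k. snd ` D' k)"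
    then obtain x where x: "(x, w) \<in> A" by auto
    then obtain i where "(x, w) \<in> B i" using A(2) by (auto simp: B_def)
    then have "w \<in> snd ` B i" by force
    moreover have "w \<notin> snd ` D i j" for j using w by (auto simp: D'_def dest!: spec[of _ "prod_encode (i, j)"])
    ultimately show "w \<in> (\<Union>i. snd ` B i - (\<Union>j. snd ` D i j))" by blast
  qed
  then have "snd ` A - (\<Union>k. snd ` D' k) \<in> null_sets M"
    using D(3) by (rule complete2[OF _ null_sets_UN])
  moreover have "D' k \<subseteq> A" for k using D(1) by (auto simp: D'_def B_def)
  ultimately show ?thesis using D(2) by (intro exI[of _ D']) (auto simp: D'_def)
qed

theorem measurable_projection:
  fixes K :: "nat \<Rightarrow> 'b::metric_space set"
  assumes "\<And>i. compact (K i)" and "A \<in> sets (borel \<Otimes>\<^sub>M M)" "A \<subseteq> (\<Union>i. K i) \<times> space M"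
  shows "snd ` A \<in> sets M"
proof -
  obtain D where D: "\<And>j::nat. D j \<subseteq> A" "\<And>j. compact_meas M (D j)"
    and N: "snd ` A - (\<Union>j. snd ` D j) \<in> null_sets M"
    using compact_exhaustion_sigma[OF assms] by blast
  have "(\<Union>j. snd ` D j) \<in> sets M" using D(2) by (auto simp: compact_meas_def)
  moreover have "snd ` A = (\<Union>j. snd ` D j) \<union> (snd ` A - (\<Union>j. snd ` D j))" using D(1) by blast
  ultimately show ?thesis using N by (metis null_setsD2 sets.Un)
qed

end

section \<open>Measurable selection and lower semicontinuous envelopes\<close>

lemma closed_Rn: "closed (Rn k)"
proof -
  have "Rn k = (\<Inter>i\<in>{k..}. (\<lambda>x. x i) -` {0})" by (auto simp: Rn_def)
  then show ?thesis
    by (auto intro!: closed_INT closed_vimage continuous_on_product_coordinates)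
qed

definition box_Rn :: "nat \<Rightarrow> real \<Rightarrow> (nat \<Rightarrow> real) set" where
  "box_Rn k r = {x \<in> Rn k. \<forall>i<k. \<bar>x i\<bar> \<le> r}"

lemma compact_box_Rn: "compact (box_Rn k r)"
proof -
  have "compactin (product_topology (\<lambda>_. euclidean) UNIV)
      (PiE UNIV (\<lambda>i. if i < k then {-r..r} else {0::real}))"
    unfolding compactin_PiE by auto
  moreover have "PiE UNIV (\<lambda>i. if i < k then {-r..r} else {0}) = box_Rn k r"
    by (auto simp: box_Rn_def Rn_def PiE_iff abs_le_iff split: if_splits) (smt (verit))+
  ultimately show ?thesis by (simp add: euclidean_product_topology)
qed

lemma Rn_eq_UN_box: "Rn k = (\<Union>N::nat. box_Rn k (real N))"
proof
  show "Rn k \<subseteq> (\<Union>N::nat. box_Rn k (real N))"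
  proof
    fix x assume x: "x \<in> Rn k"
    obtain N :: nat where N: "(\<Sum>i<k. \<bar>x i\<bar>) \<le> real N" using real_arch_simple by blast
    have "\<bar>x i\<bar> \<le> real N" if "i < k" for i
      using member_le_sum[of i "{..<k}" "\<lambda>i. \<bar>x i\<bar>"] that N by simp
    then show "x \<in> (\<Union>N::nat. box_Rn k (real N))" using x by (auto simp: box_Rn_def)
  qed
qed (auto simp: box_Rn_def)

definition proj_Rn :: "nat \<Rightarrow> (nat \<Rightarrow> real) \<Rightarrow> nat \<Rightarrow> real" where
  "proj_Rn k x = (\<lambda>i. if i < k then x i else 0)"

lemma proj_Rn_in [simp]: "proj_Rn k x \<in> Rn k"
  by (auto simp: proj_Rn_def Rn_def)

lemma proj_Rn_id: "x \<in> Rn k \<Longrightarrow> proj_Rn k x = x"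
  by (auto simp: proj_Rn_def Rn_def)

lemma measurable_to_borel_fun:
  fixes f :: "'a \<Rightarrow> nat \<Rightarrow> real"
  assumes "\<And>i. (\<lambda>w. f w i) \<in> borel_measurable M"
  shows "f \<in> borel_measurable M"
  using measurable_coordinatewise_then_product[of f M] assms by simp

lemma measurable_coord [measurable]: "(\<lambda>x::nat \<Rightarrow> real. x i) \<in> borel_measurable borel"
  by (intro borel_measurable_continuous_onI continuous_on_product_coordinates)

lemma measurable_borel_RnI:
  assumes "\<And>i. (\<lambda>w. f w i) \<in> borel_measurable M" "\<And>w. w \<in> space M \<Longrightarrow> f w \<in> Rn k"
  shows "f \<in> measurable M (borel_Rn k)"
  using assms by (intro measurable_restrict_space2 measurable_to_borel_fun) auto

lemma measurable_borel_Rn_coord: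
  assumes "f \<in> measurable M (borel_Rn k)"
  shows "(\<lambda>w. f w i) \<in> borel_measurable M"
proof -
  have "f \<in> borel_measurable M" using assms measurable_restrict_space2_iff by blast
  then show ?thesis by (rule measurable_compose) (rule measurable_coord)
qed

lemma measurable_borel_Rn_in:
  "f \<in> measurable M (borel_Rn k) \<Longrightarrow> w \<in> space M \<Longrightarrow> f w \<in> Rn k"
  using measurable_space[of f M "borel_Rn k" w] by (simp add: space_restrict_space)

lemma measurable_proj_Rn: "proj_Rn k \<in> measurable borel (borel_Rn k)"
proof (rule measurable_borel_RnI)
  show "(\<lambda>w. proj_Rn k w i) \<in> borel_measurable borel" for i
    by (cases "i < k") (auto simp: proj_Rn_def intro: measurable_coord)
qed simp

lemma borel_Rn_pair_subset: "A \<in> sets (borel_Rn k \<Otimes>\<^sub>M M) \<Longrightarrow> A \<subseteq> Rn k \<times> space M"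
  using sets.sets_into_space[of A "borel_Rn k \<Otimes>\<^sub>M M"] by (simp add: space_pair_measure space_restrict_space)

text \<open>The measurable retraction \<open>proj_Rn\<close> pulls \<open>A\<close> back to the
  ambient sequence space, and cutting with the closed set \<open>Rn k\<close> recovers
  \<open>A\<close>. This connects integrands on \<open>Rn k\<close> with the projection
  theorem.\<close>

lemma sets_borel_Rn_pair:
  assumes A: "A \<in> sets (borel_Rn k \<Otimes>\<^sub>M M)"
  shows "A \<in> sets (borel \<Otimes>\<^sub>M M)"
proof -
  have "(\<lambda>(x, w). (proj_Rn k x, w)) \<in> measurable (borel \<Otimes>\<^sub>M M) (borel_Rn k \<Otimes>\<^sub>M M)"
    using measurable_proj_Rn by (auto simp: split_beta intro!: measurable_Pair measurable_compose[OF measurable_fst])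
  note measurable_sets[OF this A]
  moreover have "Rn k \<times> space M \<in> sets (borel \<Otimes>\<^sub>M M)"
    using closed_Rn by (intro pair_measureI) auto
  ultimately have "((\<lambda>(x, w). (proj_Rn k x, w)) -` A \<inter> space (borel \<Otimes>\<^sub>M M)) \<inter> (Rn k \<times> space M) \<in> sets (borel \<Otimes>\<^sub>M M)"
    by (rule sets.Int)
  also have "((\<lambda>(x, w). (proj_Rn k x, w)) -` A \<inter> space (borel \<Otimes>\<^sub>M M)) \<inter> (Rn k \<times> space M) = A"
    using borel_Rn_pair_subset[OF A] by (auto simp: proj_Rn_id space_pair_measure)
  finally show ?thesis .
qed

text \<open>The lexicographically smallest point of each compact section is a measurable selection.\<close>

primrec lexmin :: "((nat \<Rightarrow> real) \<times> 'a) set \<Rightarrow> nat \<Rightarrow> ((nat \<Rightarrow> real) \<times> 'a) set" where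
  "lexmin D 0 = D"
| "lexmin D (Suc i) = {(x, w) \<in> lexmin D i. x i = Inf ((\<lambda>x. x i) ` {x. (x, w) \<in> lexmin D i})}"

context complete_finite_measure
begin

lemma projection_Rn':
  assumes "A \<in> sets (borel \<Otimes>\<^sub>M M)" "A \<subseteq> Rn k \<times> space M"
  shows "snd ` A \<in> sets M"
  using assms compact_box_Rn Rn_eq_UN_box
  by (intro measurable_projection[of "\<lambda>N. box_Rn k (real N)"]) auto

lemma projection_Rn:
  assumes "A \<in> sets (borel_Rn k \<Otimes>\<^sub>M M)"
  shows "snd ` A \<in> sets M"
  using sets_borel_Rn_pair[OF assms] borel_Rn_pair_subset[OF assms] by (rule projection_Rn')

text \<open>Coordinate \<open>i\<close> of the selection is its minimum over the section that is
  left after minimizing the earlier coordinates. It is at most \<open>a\<close> iff that section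
  meets a closed half-space, an event that is a projection and hence measurable.\<close>

lemma compact_selection:
  fixes D :: "((nat \<Rightarrow> real) \<times> 'a) set"
  assumes D: "compact_meas M D" "D \<subseteq> Rn k \<times> space M"
  shows "\<exists>s\<in>borel_measurable M. \<forall>w\<in>snd ` D. (s w, w) \<in> D"
proof -
  define \<mu> where "\<mu> i w = Inf ((\<lambda>x. x i) ` {x. (x, w) \<in> lexmin D i})" for i w
  have sub: "lexmin D i \<subseteq> D" for i by (induction i) auto
  have attain: "\<exists>x. (x, w) \<in> E \<and> x i = Inf ((\<lambda>x. x i) ` {x. (x, w) \<in> E}) \<and> (\<forall>y. (y, w) \<in> E \<longrightarrow> x i \<le> y i)"
    if "compact {x. (x, w) \<in> E}" "w \<in> snd ` E" for E :: "((nat \<Rightarrow> real) \<times> 'a) set" and i w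
  proof -
    have "{x. (x, w) \<in> E} \<noteq> {}" using that by force
    then obtain x where x: "(x, w) \<in> E" "\<And>y. (y, w) \<in> E \<Longrightarrow> x i \<le> y i"
      using continuous_attains_inf[OF \<open>compact {x. (x, w) \<in> E}\<close>, of "\<lambda>x. x i"]
        continuous_on_subset[OF continuous_on_product_coordinates, of "{x. (x, w) \<in> E}" i] by auto
    then have "Inf ((\<lambda>x. x i) ` {x. (x, w) \<in> E}) = x i" by (intro cInf_eq_minimum) auto
    then show ?thesis using x by auto
  qed
  have meas: "\<mu> i \<in> borel_measurable M"
    if E: "compact_meas M (lexmin D i)" "snd ` lexmin D i = snd ` D" for i
  proof (rule borel_measurableI_le)
    fix a
    let ?E = "lexmin D i"
    have [measurable]: "?E \<in> sets (borel \<Otimes>\<^sub>M M)" "snd ` D \<in> sets M"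
      using E by (auto simp: compact_meas_def)
    have "?E \<inter> {p \<in> space (borel \<Otimes>\<^sub>M M). fst p i \<le> a} \<in> sets (borel \<Otimes>\<^sub>M M)" by measurable
    then have "snd ` (?E \<inter> {p \<in> space (borel \<Otimes>\<^sub>M M). fst p i \<le> a}) \<in> sets M"
      by (rule projection_Rn') (use sub D(2) in blast)
    \<comment> \<open>Off the projection of \<open>D\<close> the section is empty and
      \<open>\<mu> i\<close> has the default value \<open>Inf {}\<close>, so there the sublevel set
      is everything or nothing.\<close>
    moreover have "{w \<in> space M. \<mu> i w \<le> a} = snd ` (?E \<inter> {p \<in> space (borel \<Otimes>\<^sub>M M). fst p i \<le> a}) \<union>
        (if Inf {} \<le> a then space M - snd ` D else {})" (is "?L = ?R1 \<union> ?R2")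
    proof (rule set_eqI)
      fix w show "w \<in> ?L \<longleftrightarrow> w \<in> ?R1 \<union> ?R2"
      proof (cases "w \<in> snd ` D")
        case True
        then have "w \<in> space M" using D(2) by auto
        have "w \<in> snd ` ?E" using True E by simp
        then obtain x where x: "(x, w) \<in> ?E" "x i = \<mu> i w" "\<And>y. (y, w) \<in> ?E \<Longrightarrow> x i \<le> y i"
          using attain[of w ?E i] E by (auto simp: \<mu>_def compact_meas_def)
        show ?thesis
        proof
          assume "w \<in> ?L"
          then have "(x, w) \<in> ?E \<inter> {p \<in> space (borel \<Otimes>\<^sub>M M). fst p i \<le> a}"
            using x by (auto simp: space_pair_measure)
          then show "w \<in> ?R1 \<union> ?R2" by force
        next
          assume "w \<in> ?R1 \<union> ?R2"
          then obtain y where "(y, w) \<in> ?E" "y i \<le> a" using True by (auto split: if_splits)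
          then show "w \<in> ?L" using x \<open>w \<in> space M\<close> by fastforce
        qed
      next
        case False
        then have "{x. (x, w) \<in> ?E} = {}" "w \<notin> ?R1" using sub by force+
        then show ?thesis using False by (simp add: \<mu>_def)
      qed
    qed
    ultimately show "{w \<in> space M. \<mu> i w \<le> a} \<in> sets M" by simp
  qed
  have inv: "compact_meas M (lexmin D i) \<and> snd ` lexmin D i = snd ` D" for i
  proof (induction i)
    case (Suc i)
    let ?E = "lexmin D i"
    from Suc have E[measurable]: "?E \<in> sets (borel \<Otimes>\<^sub>M M)" and c: "\<And>w. compact {x. (x, w) \<in> ?E}"
      and sE: "snd ` ?E = snd ` D" "snd ` D \<in> sets M"
      by (auto simp: compact_meas_def)
    have [measurable]: "\<mu> i \<in> borel_measurable M" using Suc meas by blast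
    have eq: "lexmin D (Suc i) = ?E \<inter> {p \<in> space (borel \<Otimes>\<^sub>M M). fst p i = \<mu> i (snd p)}"
      using sets.sets_into_space[OF E] by (auto simp: \<mu>_def)
    have "lexmin D (Suc i) \<in> sets (borel \<Otimes>\<^sub>M M)" unfolding eq by measurable
    moreover have "compact {x. (x, w) \<in> lexmin D (Suc i)}" for w
    proof -
      have "{x. (x, w) \<in> lexmin D (Suc i)} = {x. (x, w) \<in> ?E} \<inter> (\<lambda>x. x i) -` {\<mu> i w}"
        by (auto simp: \<mu>_def)
      then show ?thesis
        using compact_Int_closed[OF c closed_vimage[OF closed_singleton continuous_on_product_coordinates]] by simp
    qed
    moreover have "snd ` D \<subseteq> snd ` lexmin D (Suc i)"
    proof
      fix w assume "w \<in> snd ` D"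
      then obtain x where "(x, w) \<in> ?E" "x i = \<mu> i w"
        using attain[OF c, of w i] sE by (auto simp: \<mu>_def)
      then have "(x, w) \<in> lexmin D (Suc i)" by (simp add: \<mu>_def)
      then show "w \<in> snd ` lexmin D (Suc i)" by force
    qed
    then have "snd ` lexmin D (Suc i) = snd ` D" using image_mono[OF sub, of snd "Suc i"] by blast
    ultimately show ?case using sE(2) by (simp add: compact_meas_def del: lexmin.simps)
  qed (use D in simp)
  show ?thesis
  proof (intro bexI ballI)
    show "(\<lambda>w i. \<mu> i w) \<in> borel_measurable M" using inv meas by (intro measurable_to_borel_fun) auto
    fix w assume w: "w \<in> snd ` D"
    \<comment> \<open>Fixing all coordinates in turn leaves nested compact sections, so a point
      survives; each of its coordinates is determined, hence it is the selection.\<close>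
    have "decseq (lexmin D)" by (intro decseq_SucI) auto
    then have "snd ` (\<Inter>i. lexmin D i) = (\<Inter>i. snd ` lexmin D i)"
      using inv by (intro proj_decseq_INT) (auto simp: compact_meas_def)
    then have "w \<in> snd ` (\<Inter>i. lexmin D i)" using inv w by simp
    then obtain x where "\<forall>i. (x, w) \<in> lexmin D i" by auto
    then have x: "(x, w) \<in> lexmin D i" for i by blast
    have "x i = \<mu> i w" for i using x[of "Suc i"] by (simp add: \<mu>_def)
    then have "x = (\<lambda>i. \<mu> i w)" by auto
    then show "((\<lambda>i. \<mu> i w), w) \<in> D" using x[of 0] by simp
  qed
qed

text \<open>Selections on countably many pieces are glued by taking the first piece that lies over
  \<open>w\<close>. The exceptions are contained in the null set that the pieces miss.\<close>

lemma measurable_selection: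
  assumes A: "A \<in> sets (borel_Rn k \<Otimes>\<^sub>M M)"
  shows "\<exists>s\<in>measurable M (borel_Rn k). AE w in M. w \<in> snd ` A \<longrightarrow> (s w, w) \<in> A"
proof -
  have "A \<subseteq> (\<Union>N. box_Rn k (real N)) \<times> space M"
    using borel_Rn_pair_subset[OF A] by (simp add: Rn_eq_UN_box)
  note compact_exhaustion_sigma[OF compact_box_Rn sets_borel_Rn_pair[OF A] this]
  then obtain D where D: "\<And>j::nat. D j \<subseteq> A" "\<And>j. compact_meas M (D j)"
    and N: "snd ` A - (\<Union>j. snd ` D j) \<in> null_sets M"
    by blast
  have "\<exists>s\<in>borel_measurable M. \<forall>w\<in>snd ` D j. (s w, w) \<in> D j" for j
    using D(1)[of j] borel_Rn_pair_subset[OF A] by (intro compact_selection[of _ k] D) auto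
  then obtain s where s[measurable]: "\<And>j. s j \<in> borel_measurable M"
    and sD: "\<And>j w. w \<in> snd ` D j \<Longrightarrow> (s j w, w) \<in> D j" by metis
  have [measurable]: "snd ` D j \<in> sets M" for j using D(2) by (simp add: compact_meas_def)
  define J where "J w = (LEAST j. w \<in> snd ` D j)" for w
  have [measurable]: "J \<in> measurable M (count_space UNIV)" unfolding J_def by measurable
  define t where "t w = (if w \<in> (\<Union>j. snd ` D j) then s (J w) w else (\<lambda>_. 0))" for w
  have t: "(t w, w) \<in> A" if "w \<in> (\<Union>j. snd ` D j)" for w
  proof -
    have "w \<in> snd ` D (J w)" using that unfolding J_def by (auto intro: LeastI)
    then show ?thesis using sD D(1) that by (auto simp: t_def)
  qed
  have "t \<in> borel_measurable M"
  proof -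
    have "(\<lambda>w. s (J w) w) \<in> borel_measurable M"
      by (rule measurable_compose_countable[where g = J]) auto
    then show ?thesis unfolding t_def by measurable
  qed
  moreover have "t w \<in> Rn k" for w
  proof (cases "w \<in> (\<Union>j. snd ` D j)")
    case True then show ?thesis using t borel_Rn_pair_subset[OF A] by blast
  qed (auto simp: t_def Rn_def)
  ultimately have "t \<in> measurable M (borel_Rn k)" by (intro measurable_restrict_space2) auto
  moreover have "AE w in M. w \<in> snd ` A \<longrightarrow> (t w, w) \<in> A"
    using AE_not_in[OF N] by eventually_elim (use t in blast)
  ultimately show ?thesis by blast
qed

text \<open>The infimum runs over an uncountable set, but its strict sublevel sets are projections
  of strict sublevel sets of the integrand.\<close>

lemma measurable_INF_Rn:
  assumes [measurable]: "(\<lambda>(x, w). g x w) \<in> borel_measurable (borel_Rn k \<Otimes>\<^sub>M M)" and U[measurable]: "U \<in> sets borel"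
  shows "(\<lambda>w. INF x\<in>U \<inter> Rn k. g x w :: ereal) \<in> borel_measurable M"
proof (rule borel_measurableI_less)
  fix a
  let ?A = "{p \<in> space (borel_Rn k \<Otimes>\<^sub>M M). fst p \<in> U \<and> (case p of (x, w) \<Rightarrow> g x w) < a}"
  have 1: "U \<inter> Rn k \<in> sets (borel_Rn k)"
    unfolding sets_restrict_space by (rule image_eqI[of _ _ U]) auto
  have "?A = {p \<in> space (borel_Rn k \<Otimes>\<^sub>M M). fst p \<in> U \<inter> Rn k \<and> (case p of (x, w) \<Rightarrow> g x w) < a}"
    by (auto simp: space_pair_measure space_restrict_space)
  also have "\<dots> \<in> sets (borel_Rn k \<Otimes>\<^sub>M M)" using 1 by measurable
  finally have "snd ` ?A \<in> sets M" by (rule projection_Rn)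
  also have "snd ` ?A = {w \<in> space M. (INF x\<in>U \<inter> Rn k. g x w) < a}"
    by (auto simp: INF_less_iff space_pair_measure space_restrict_space image_iff Bex_def)
  finally show "{w \<in> space M. (INF x\<in>U \<inter> Rn k. g x w) < a} \<in> sets M" .
qed

end

section \<open>Lower semicontinuity through a countable base\<close>

lemma lsc_on_iff:
  "lsc_on A f \<longleftrightarrow> (\<forall>x\<in>A. \<forall>y<f x. \<exists>U. open U \<and> x \<in> U \<and> (\<forall>z\<in>U \<inter> A. y < f z))"
proof -
  have "(\<exists>S. open S \<and> x \<in> S \<and> (\<forall>z\<in>S. z \<noteq> x \<longrightarrow> z \<in> A \<longrightarrow> y < f z)) \<longleftrightarrow>
        (\<exists>U. open U \<and> x \<in> U \<and> (\<forall>z\<in>U \<inter> A. y < f z))" if "y < f x" for x y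
    using that by (intro ex_cong1) auto
  then show ?thesis
    unfolding lsc_on_def le_Liminf_iff eventually_at_topological by simp
qed

lemma lsc_onD:
  "lsc_on A f \<Longrightarrow> x \<in> A \<Longrightarrow> y < f x \<Longrightarrow> \<exists>U. open U \<and> x \<in> U \<and> (\<forall>z\<in>U \<inter> A. y < f z)"
  by (simp add: lsc_on_iff)

definition cbase :: "nat \<Rightarrow> 'b::second_countable_topology set" where
  "cbase = from_nat_into (SOME B. countable B \<and> topological_basis B)"

lemma cbase: "topological_basis (range (cbase :: nat \<Rightarrow> 'b::second_countable_topology set))"
proof -
  define B where "B = (SOME B :: 'b set set. countable B \<and> topological_basis B)"
  have B: "countable B" "topological_basis B"
    using someI_ex[OF ex_countable_basis[where 'a = 'b]] by (auto simp: B_def)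
  have "B \<noteq> {}"
    using topological_basisE[OF B(2) open_UNIV UNIV_I] by auto
  then show ?thesis using B by (simp add: cbase_def B_def[symmetric] range_from_nat_into)
qed

lemma open_cbase: "open (cbase i)"
  using topological_basis_open[OF cbase] by blast

lemma cbase_ex: "open S \<Longrightarrow> x \<in> S \<Longrightarrow> \<exists>i. x \<in> cbase i \<and> cbase i \<subseteq> S"
  using topological_basisE[OF cbase, of S x] by blast

definition cinter :: "nat list \<Rightarrow> 'b::second_countable_topology set" where
  "cinter l = (\<Inter>i\<in>set l. cbase i)"

lemma open_cinter: "open (cinter l)"
  by (auto simp: cinter_def intro!: open_INT open_cbase)

text \<open>Encodes a decreasing sequence of neighbourhoods of \<open>x\<close>. For fixed
  \<open>j\<close> only finitely many lists occur as \<open>x\<close> varies, so a random point can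
  be inserted and the probability space split into finitely many events.\<close>

definition nbhd_index :: "nat \<Rightarrow> 'b::second_countable_topology \<Rightarrow> nat list" where
  "nbhd_index j x = filter (\<lambda>i. x \<in> cbase i) [0..<j]"

lemma nbhd_index_mem: "x \<in> cinter (nbhd_index j x)"
  by (auto simp: cinter_def nbhd_index_def)

lemma cinter_nbhd_index_antimono: "i \<le> j \<Longrightarrow> cinter (nbhd_index j x) \<subseteq> cinter (nbhd_index i x)"
  by (auto simp: cinter_def nbhd_index_def)

lemma lsc_on_SUP_nbhd:
  assumes "lsc_on A f" "x \<in> A"
  shows "(SUP j. INF y\<in>cinter (nbhd_index j x) \<inter> A. f y) = f x"
proof (rule antisym)
  show "(SUP j. INF y\<in>cinter (nbhd_index j x) \<inter> A. f y) \<le> f x"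
    using assms(2) nbhd_index_mem by (intro SUP_least INF_lower) auto
  show "f x \<le> (SUP j. INF y\<in>cinter (nbhd_index j x) \<inter> A. f y)"
  proof (rule dense_le)
    fix y assume "y < f x"
    then obtain U where U: "open U" "x \<in> U" "\<forall>z\<in>U \<inter> A. y < f z"
      using lsc_onD[OF assms] by blast
    then obtain i where i: "x \<in> cbase i" "cbase i \<subseteq> U" using cbase_ex by blast
    \<comment> \<open>\<open>nbhd_index j\<close> inspects the indices below \<open>j\<close>, hence
      \<open>Suc i\<close>.\<close>
    then have "cinter (nbhd_index (Suc i) x) \<subseteq> U" by (auto simp: cinter_def nbhd_index_def)
    then have "y \<le> (INF y\<in>cinter (nbhd_index (Suc i) x) \<inter> A. f y)"
      using U(3) by (intro INF_greatest less_imp_le) blast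
    then show "y \<le> (SUP j. INF y\<in>cinter (nbhd_index j x) \<inter> A. f y)"
      by (rule order_trans) (rule SUP_upper, simp)
  qed
qed

text \<open>Rebuilds a function from values attached to countably many open sets. Every choice of
  \<open>e\<close> yields a lower semicontinuous function, and if the values depend measurably on a
  parameter, the result is jointly measurable. With infima of a lower semicontinuous function as
  values, that function is recovered.\<close>

definition lsc_env :: "(nat list \<Rightarrow> ereal) \<Rightarrow> 'b::second_countable_topology \<Rightarrow> ereal" where
  "lsc_env e x = (SUP l. if x \<in> cinter l then e l else -\<infinity>)"

lemma lsc_env_upper: "x \<in> cinter l \<Longrightarrow> e l \<le> lsc_env e x"
  unfolding lsc_env_def by (rule SUP_upper2[of l]) auto

lemma lsc_env_least: "(\<And>l. x \<in> cinter l \<Longrightarrow> e l \<le> c) \<Longrightarrow> lsc_env e x \<le> c"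
  unfolding lsc_env_def by (rule SUP_least) auto

lemma lsc_on_lsc_env:
  fixes A :: "'b::second_countable_topology set"
  shows "lsc_on A (lsc_env e)"
  unfolding lsc_on_iff
proof (intro ballI allI impI)
  fix x :: 'b and y assume "y < lsc_env e x"
  then obtain l where "y < (if x \<in> cinter l then e l else -\<infinity>)" unfolding lsc_env_def less_SUP_iff by blast
  then have "x \<in> cinter l" "y < e l" by (auto split: if_splits)
  then show "\<exists>U. open U \<and> x \<in> U \<and> (\<forall>z\<in>U \<inter> A. y < lsc_env e z)"
    by (intro exI[of _ "cinter l"]) (auto intro: open_cinter less_le_trans lsc_env_upper)
qed

lemma lsc_on_eq_lsc_env:
  assumes "lsc_on A f" "x \<in> A"
  shows "lsc_env (\<lambda>l. INF y\<in>cinter l \<inter> A. f y) x = f x"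
proof (rule antisym)
  show "lsc_env (\<lambda>l. INF y\<in>cinter l \<inter> A. f y) x \<le> f x"
    using assms(2) by (intro lsc_env_least INF_lower) auto
  show "f x \<le> lsc_env (\<lambda>l. INF y\<in>cinter l \<inter> A. f y) x"
    unfolding lsc_on_SUP_nbhd[OF assms, symmetric]
    by (rule SUP_least) (rule lsc_env_upper[OF nbhd_index_mem, of "\<lambda>l. INF y\<in>cinter l \<inter> A. f y"])
qed

lemma normal_integrand_lsc_env:
  assumes [measurable]: "\<And>l. e l \<in> borel_measurable G"
  shows "normal_integrand G k (\<lambda>x w. lsc_env (\<lambda>l. e l w) x)"
proof -
  have "(\<lambda>p. SUP l. if fst p \<in> cinter l then e l (snd p) else -\<infinity>) \<in> borel_measurable (borel_Rn k \<Otimes>\<^sub>M G)"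
  proof (intro borel_measurable_SUP measurable_If)
    fix l :: "nat list"
    have "cinter l \<inter> Rn k \<in> sets (borel_Rn k)"
      unfolding sets_restrict_space by (rule image_eqI[of _ _ "cinter l"]) (auto intro: borel_open open_cinter)
    then have "{p \<in> space (borel_Rn k \<Otimes>\<^sub>M G). fst p \<in> cinter l \<inter> Rn k} \<in> sets (borel_Rn k \<Otimes>\<^sub>M G)" by measurable
    also have "{p \<in> space (borel_Rn k \<Otimes>\<^sub>M G). fst p \<in> cinter l \<inter> Rn k} = {p \<in> space (borel_Rn k \<Otimes>\<^sub>M G). fst p \<in> cinter l}"
      by (auto simp: space_pair_measure space_restrict_space)
    finally show "{p \<in> space (borel_Rn k \<Otimes>\<^sub>M G). fst p \<in> cinter l} \<in> sets (borel_Rn k \<Otimes>\<^sub>M G)" .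
  qed auto
  then show ?thesis
    unfolding normal_integrand_def split_beta lsc_env_def[symmetric] by (simp add: lsc_on_lsc_env)
qed

section \<open>Expectations of functions with an integrable lower bound\<close>

text \<open>Compares the decomposition into positive and negative part with another decomposition
  \<open>p - q\<close>. The equation is written with sums because these can be integrated even where
  values are infinite; \<open>ennreal_parts_cancel\<close> turns it back into differences.\<close>

lemma ennreal_parts_eq:
  assumes "q < top"
  shows "e2ennreal (enn2ereal p - enn2ereal q) + q = e2ennreal (- (enn2ereal p - enn2ereal q)) + p"
  using assms
  by (cases p rule: ennreal_cases; cases q rule: ennreal_cases)
     (auto simp: enn2ereal_ennreal ennreal_neg ennreal_plus_if max_def simp flip: ennreal_plus)

lemma ennreal_parts_cancel:
  assumes "a + q = b + p" "q < top" "b < top"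
  shows "enn2ereal a - enn2ereal b = enn2ereal p - enn2ereal q"
  using assms
  by (cases a rule: ennreal_cases; cases b rule: ennreal_cases; cases p rule: ennreal_cases; cases q rule: ennreal_cases)
     (auto simp: enn2ereal_ennreal simp flip: ennreal_plus)

lemma e2ennreal_uminus_diff_le: "e2ennreal (- (enn2ereal p - enn2ereal q)) \<le> q"
  by (cases p rule: ennreal_cases; cases q rule: ennreal_cases)
     (auto simp: enn2ereal_ennreal e2ennreal_neg intro!: ennreal_leI)

text \<open>The nonnegative excess of \<open>f\<close> over the real bound \<open>m\<close> absorbs
  all infinite values, and the subtracted term is the negative part of \<open>m\<close>.\<close>

lemma ennreal_parts_eq_lower:
  assumes "ereal m \<le> f"
  shows "f = enn2ereal (e2ennreal (f - ereal m) + ennreal m) - enn2ereal (ennreal (- m))"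
  using assms
  by (cases f; cases "0 \<le> m") (auto simp: enn2ereal_ennreal ennreal_neg plus_ennreal.rep_eq zero_ennreal.rep_eq simp flip: ennreal_plus)

lemma ennreal_le_e2ennreal: "ereal m \<le> f \<Longrightarrow> ennreal m \<le> e2ennreal f"
  using e2ennreal_mono[of "ereal m" f] by simp

lemma e2ennreal_uminus_le: "ereal m \<le> f \<Longrightarrow> e2ennreal (- f) \<le> ennreal (- m)"
  by (cases f) (auto intro: ennreal_leI simp: e2ennreal_neg)

lemma expect_mono:
  assumes "AE w in M. f w \<le> g w"
  shows "expect M f \<le> expect M g"
  unfolding expect_def
proof (rule ereal_minus_mono)
  show "enn2ereal (\<integral>\<^sup>+w. e2ennreal (f w) \<partial>M) \<le> enn2ereal (\<integral>\<^sup>+w. e2ennreal (g w) \<partial>M)"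
    unfolding less_eq_ennreal.rep_eq[symmetric]
    by (rule nn_integral_mono_AE) (use assms in eventually_elim, rule e2ennreal_mono)
  show "enn2ereal (\<integral>\<^sup>+w. e2ennreal (- g w) \<partial>M) \<le> enn2ereal (\<integral>\<^sup>+w. e2ennreal (- f w) \<partial>M)"
    unfolding less_eq_ennreal.rep_eq[symmetric]
    by (rule nn_integral_mono_AE) (use assms in eventually_elim, rule e2ennreal_mono, simp)
qed

lemma expect_cong: "AE w in M. f w = g w \<Longrightarrow> expect M f = expect M g"
  by (intro antisym expect_mono) (auto elim!: eventually_mono)

lemma expect_diff:
  assumes f: "AE w in M. f w = enn2ereal (p w) - enn2ereal (q w)"
    and [measurable]: "p \<in> borel_measurable M" "q \<in> borel_measurable M"
    and q: "(\<integral>\<^sup>+w. q w \<partial>M) < top"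
  shows "expect M f = enn2ereal (\<integral>\<^sup>+w. p w \<partial>M) - enn2ereal (\<integral>\<^sup>+w. q w \<partial>M)"
proof -
  let ?c = "\<lambda>w. enn2ereal (p w) - enn2ereal (q w)"
  have "(\<integral>\<^sup>+w. e2ennreal (?c w) \<partial>M) + (\<integral>\<^sup>+w. q w \<partial>M) = (\<integral>\<^sup>+w. e2ennreal (?c w) + q w \<partial>M)"
    by (intro nn_integral_add[symmetric]) auto
  also have "\<dots> = (\<integral>\<^sup>+w. e2ennreal (- ?c w) + p w \<partial>M)"
  proof (rule nn_integral_cong_AE)
    have "AE w in M. q w \<noteq> \<infinity>" using q by (intro nn_integral_PInf_AE) auto
    then show "AE w in M. e2ennreal (?c w) + q w = e2ennreal (- ?c w) + p w"
      by eventually_elim (rule ennreal_parts_eq, simp add: less_top)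
  qed
  also have "\<dots> = (\<integral>\<^sup>+w. e2ennreal (- ?c w) \<partial>M) + (\<integral>\<^sup>+w. p w \<partial>M)"
    by (intro nn_integral_add) auto
  finally have eq: "(\<integral>\<^sup>+w. e2ennreal (?c w) \<partial>M) + (\<integral>\<^sup>+w. q w \<partial>M) =
      (\<integral>\<^sup>+w. e2ennreal (- ?c w) \<partial>M) + (\<integral>\<^sup>+w. p w \<partial>M)" .
  have "(\<integral>\<^sup>+w. e2ennreal (- ?c w) \<partial>M) \<le> (\<integral>\<^sup>+w. q w \<partial>M)"
    by (intro nn_integral_mono e2ennreal_uminus_diff_le)
  then have "(\<integral>\<^sup>+w. e2ennreal (- ?c w) \<partial>M) < top" using q by (rule le_less_trans)
  then have "expect M ?c = enn2ereal (\<integral>\<^sup>+w. p w \<partial>M) - enn2ereal (\<integral>\<^sup>+w. q w \<partial>M)"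
    unfolding expect_def by (rule ennreal_parts_cancel[OF eq q])
  then show ?thesis using expect_cong[OF f] by simp
qed

lemma integrable_neg_part:
  assumes m: "integrable M m"
  shows "(\<integral>\<^sup>+w. ennreal (- m w) \<partial>M) < top" "(\<integral>\<^sup>+w. ennreal (m w) \<partial>M) < top"
proof -
  have "(\<integral>\<^sup>+w. ennreal \<bar>m w\<bar> \<partial>M) < top" using m by (simp add: integrable_iff_bounded)
  moreover have "(\<integral>\<^sup>+w. ennreal (- m w) \<partial>M) \<le> (\<integral>\<^sup>+w. ennreal \<bar>m w\<bar> \<partial>M)"
    "(\<integral>\<^sup>+w. ennreal (m w) \<partial>M) \<le> (\<integral>\<^sup>+w. ennreal \<bar>m w\<bar> \<partial>M)"
    by (auto intro!: nn_integral_mono ennreal_leI)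
  ultimately show "(\<integral>\<^sup>+w. ennreal (- m w) \<partial>M) < top" "(\<integral>\<^sup>+w. ennreal (m w) \<partial>M) < top" by auto
qed

lemma expect_lower:
  assumes f: "AE w in M. ereal (m w) \<le> f w" "f \<in> borel_measurable M" and m: "integrable M m"
  shows "expect M f = enn2ereal ((\<integral>\<^sup>+w. e2ennreal (f w - ereal (m w)) \<partial>M) + (\<integral>\<^sup>+w. ennreal (m w) \<partial>M))
           - enn2ereal (\<integral>\<^sup>+w. ennreal (- m w) \<partial>M)"
proof -
  have [measurable]: "m \<in> borel_measurable M" "f \<in> borel_measurable M" using m f by auto
  have "expect M f = enn2ereal (\<integral>\<^sup>+w. e2ennreal (f w - ereal (m w)) + ennreal (m w) \<partial>M)
           - enn2ereal (\<integral>\<^sup>+w. ennreal (- m w) \<partial>M)"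
    using f(1) by (intro expect_diff integrable_neg_part m) (auto elim!: eventually_mono intro: ennreal_parts_eq_lower)
  also have "(\<integral>\<^sup>+w. e2ennreal (f w - ereal (m w)) + ennreal (m w) \<partial>M) =
      (\<integral>\<^sup>+w. e2ennreal (f w - ereal (m w)) \<partial>M) + (\<integral>\<^sup>+w. ennreal (m w) \<partial>M)"
    by (rule nn_integral_add) auto
  finally show ?thesis .
qed

text \<open>Subtracting \<open>m\<close> reduces the claim to nonnegative functions with equal
  finite integrals, whose difference has integral 0. With value \<infinity> the two functions could
  differ on a set of positive measure.\<close>

lemma expect_eq_imp_AE_eq:
  assumes fg: "AE w in M. f w \<le> g w" and m: "integrable M m" "AE w in M. ereal (m w) \<le> f w"
    and [measurable]: "f \<in> borel_measurable M" "g \<in> borel_measurable M"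
    and eq: "expect M f = expect M g" and fin: "expect M f < \<infinity>"
  shows "AE w in M. f w = g w"
proof -
  have [measurable]: "m \<in> borel_measurable M" using m by auto
  have mg: "AE w in M. ereal (m w) \<le> g w" using fg m(2) by eventually_elim simp
  let ?f = "\<lambda>w. e2ennreal (f w - ereal (m w))" and ?g = "\<lambda>w. e2ennreal (g w - ereal (m w))"
  let ?a = "\<integral>\<^sup>+w. ennreal (m w) \<partial>M" and ?b = "\<integral>\<^sup>+w. ennreal (- m w) \<partial>M"
  have "?a < top" "?b < top" using integrable_neg_part[OF m(1)] by auto
  moreover have "enn2ereal (integral\<^sup>N M ?f + ?a) - enn2ereal ?b = enn2ereal (integral\<^sup>N M ?g + ?a) - enn2ereal ?b"
    "enn2ereal (integral\<^sup>N M ?f + ?a) - enn2ereal ?b < \<infinity>"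
    using expect_lower[OF m(2) _ m(1)] expect_lower[OF mg _ m(1)] eq fin by simp_all
  ultimately have *: "integral\<^sup>N M ?f = integral\<^sup>N M ?g" "integral\<^sup>N M ?f < top"
    by (cases ?a rule: ennreal_cases; cases ?b rule: ennreal_cases; cases "integral\<^sup>N M ?f" rule: ennreal_cases;
        cases "integral\<^sup>N M ?g" rule: ennreal_cases;
        auto simp: enn2ereal_ennreal simp flip: ennreal_plus)+
  have le: "AE w in M. ?f w \<le> ?g w"
    using fg by eventually_elim (auto intro!: e2ennreal_mono ereal_minus_mono)
  have "(\<integral>\<^sup>+w. ?g w - ?f w \<partial>M) = integral\<^sup>N M ?g - integral\<^sup>N M ?f"
    using *(2) le by (intro nn_integral_diff) auto
  also have "\<dots> = 0" using * by (simp add: diff_eq_0_ennreal)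
  finally have "AE w in M. ?g w - ?f w = 0" by (subst (asm) nn_integral_0_iff_AE) auto
  moreover have "AE w in M. ?f w \<noteq> \<infinity>" using *(2) by (intro nn_integral_PInf_AE) auto
  ultimately show ?thesis using fg m(2)
  proof eventually_elim
    case (elim w)
    then have "?g w \<le> ?f w" by (intro ennreal_minus_eq_0) simp
    then have "?g w = ?f w" using elim(3) by (auto intro!: antisym e2ennreal_mono ereal_minus_mono)
    with elim show ?case by (metis antisym_conv ennreal_parts_eq_lower order_trans)
  qed
qed

lemma (in complete_measure) borel_measurable_AE_eq:
  fixes f g :: "'a \<Rightarrow> 'b::topological_space"
  assumes eq: "AE w in M. f w = g w" and g: "g \<in> borel_measurable M"
  shows "f \<in> borel_measurable M"
proof (rule measurableI)
  fix S :: "'b set" assume S: "S \<in> sets borel"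
  show "f -` S \<inter> space M \<in> sets M"
  proof (rule in_sets_AE)
    show "g -` S \<inter> space M \<in> sets M" using measurable_sets[OF g S] .
    show "AE w in M. (w \<in> g -` S \<inter> space M) = (w \<in> f -` S \<inter> space M)"
      using eq by eventually_elim auto
  qed auto
qed auto

section \<open>Conditional expectations of extended real-valued functions\<close>

context sigma_finite_subalgebra
begin

lemma nn_cond_exp_finite:
  assumes [measurable]: "q \<in> borel_measurable M" and q: "(\<integral>\<^sup>+w. q w \<partial>M) < top"
  shows "AE w in M. nn_cond_exp M F q w < top"
proof -
  have "(\<integral>\<^sup>+w. nn_cond_exp M F q w \<partial>M) = (\<integral>\<^sup>+w. q w \<partial>M)"
    using nn_cond_exp_intg[of "\<lambda>_. 1" q] by simp
  then have "AE w in M. nn_cond_exp M F q w \<noteq> \<infinity>" using q by (intro nn_integral_PInf_AE) auto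
  then show ?thesis by eventually_elim (simp add: less_top)
qed

lemma ereal_cond_exp_diff:
  assumes f: "AE w in M. f w = enn2ereal (p w) - enn2ereal (q w)"
    and [measurable]: "f \<in> borel_measurable M" "p \<in> borel_measurable M" "q \<in> borel_measurable M"
    and q: "(\<integral>\<^sup>+w. q w \<partial>M) < top"
  shows "AE w in M. ereal_cond_exp M F f w = enn2ereal (nn_cond_exp M F p w) - enn2ereal (nn_cond_exp M F q w)"
proof -
  let ?f1 = "\<lambda>w. e2ennreal (f w)" and ?f2 = "\<lambda>w. e2ennreal (- f w)"
  have qf: "AE w in M. q w \<noteq> \<infinity>" using q by (intro nn_integral_PInf_AE) auto
  have "AE w in M. ?f1 w + q w = ?f2 w + p w"
    using qf f by eventually_elim (simp only:, rule ennreal_parts_eq, simp add: less_top)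
  then have 1: "AE w in M. nn_cond_exp M F (\<lambda>w. ?f1 w + q w) w = nn_cond_exp M F (\<lambda>w. ?f2 w + p w) w"
    by (intro nn_cond_exp_cong) auto
  have 2: "AE w in M. nn_cond_exp M F ?f1 w + nn_cond_exp M F q w = nn_cond_exp M F (\<lambda>w. ?f1 w + q w) w"
    by (intro nn_cond_exp_sum) auto
  have 3: "AE w in M. nn_cond_exp M F ?f2 w + nn_cond_exp M F p w = nn_cond_exp M F (\<lambda>w. ?f2 w + p w) w"
    by (intro nn_cond_exp_sum) auto
  have "(\<integral>\<^sup>+w. ?f2 w \<partial>M) \<le> (\<integral>\<^sup>+w. q w \<partial>M)"
    using f by (intro nn_integral_mono_AE) (auto elim!: eventually_mono intro: e2ennreal_uminus_diff_le)
  then have 4: "AE w in M. nn_cond_exp M F ?f2 w < top"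
    using q by (intro nn_cond_exp_finite) auto
  show ?thesis using 1 2 3 4 nn_cond_exp_finite[OF _ q]
    by (auto simp: ereal_cond_exp_def intro!: ennreal_parts_cancel)
qed

lemma expect_ereal_cond_exp:
  assumes f: "AE w in M. ereal (m w) \<le> f w" and [measurable]: "f \<in> borel_measurable M" and m: "integrable M m"
  shows "expect M (ereal_cond_exp M F f) = expect M f"
proof -
  have [measurable]: "m \<in> borel_measurable M" using m by auto
  have int: "(\<integral>\<^sup>+w. nn_cond_exp M F p w \<partial>M) = (\<integral>\<^sup>+w. p w \<partial>M)" if "p \<in> borel_measurable M" for p
    using nn_cond_exp_intg[of "\<lambda>_. 1" p] that by simp
  have "(\<integral>\<^sup>+w. e2ennreal (- f w) \<partial>M) \<le> (\<integral>\<^sup>+w. ennreal (- m w) \<partial>M)"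
    using f by (intro nn_integral_mono_AE) (auto elim!: eventually_mono intro: ennreal_le_e2ennreal e2ennreal_uminus_le)
  then have "(\<integral>\<^sup>+w. e2ennreal (- f w) \<partial>M) < top" using integrable_neg_part(1)[OF m] by (rule le_less_trans)
  then have "expect M (ereal_cond_exp M F f) =
    enn2ereal (\<integral>\<^sup>+w. nn_cond_exp M F (\<lambda>w. e2ennreal (f w)) w \<partial>M) -
    enn2ereal (\<integral>\<^sup>+w. nn_cond_exp M F (\<lambda>w. e2ennreal (- f w)) w \<partial>M)"
    by (intro expect_diff) (auto simp: ereal_cond_exp_def int)
  then show ?thesis by (simp add: int expect_def)
qed

lemma ereal_real_cond_exp:
  assumes m: "integrable M m"
  shows "AE w in M. ereal (real_cond_exp M F m w) =
    enn2ereal (nn_cond_exp M F (\<lambda>w. ennreal (m w)) w) - enn2ereal (nn_cond_exp M F (\<lambda>w. ennreal (- m w)) w)"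
proof -
  have [measurable]: "m \<in> borel_measurable M" using m by auto
  have "AE w in M. nn_cond_exp M F (\<lambda>w. ennreal (m w)) w < top" "AE w in M. nn_cond_exp M F (\<lambda>w. ennreal (- m w)) w < top"
    using integrable_neg_part[OF m] by (auto intro!: nn_cond_exp_finite)
  then show ?thesis
  proof eventually_elim
    case (elim w)
    then show ?case unfolding real_cond_exp_def
      by (cases "nn_cond_exp M F (\<lambda>w. ennreal (m w)) w" rule: ennreal_cases;
          cases "nn_cond_exp M F (\<lambda>w. ennreal (- m w)) w" rule: ennreal_cases) (auto simp: enn2ereal_ennreal)
  qed
qed

lemma ereal_cond_exp_lower_bound:
  assumes f: "AE w in M. ereal (m w) \<le> f w" and [measurable]: "f \<in> borel_measurable M" and m: "integrable M m"
  shows "AE w in M. ereal (real_cond_exp M F m w) \<le> ereal_cond_exp M F f w"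
proof -
  have [measurable]: "m \<in> borel_measurable M" using m by auto
  have "AE w in M. nn_cond_exp M F (\<lambda>w. ennreal (m w)) w \<le> nn_cond_exp M F (\<lambda>w. e2ennreal (f w)) w"
    using f by (intro nn_cond_exp_mono) (auto elim!: eventually_mono intro: ennreal_le_e2ennreal e2ennreal_uminus_le)
  moreover have "AE w in M. nn_cond_exp M F (\<lambda>w. e2ennreal (- f w)) w \<le> nn_cond_exp M F (\<lambda>w. ennreal (- m w)) w"
    using f by (intro nn_cond_exp_mono) (auto elim!: eventually_mono intro: ennreal_le_e2ennreal e2ennreal_uminus_le)
  ultimately show ?thesis using ereal_real_cond_exp[OF m]
    by eventually_elim (auto simp: ereal_cond_exp_def less_eq_ennreal.rep_eq intro!: ereal_minus_mono)
qed

text \<open>Isolates a nonnegative function, from whose conditional expectations the conditional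
  integrand will be built; the remaining term is real-valued.\<close>

lemma ereal_cond_exp_shift:
  assumes f: "AE w in M. ereal (m w) \<le> f w" and [measurable]: "f \<in> borel_measurable M" and m: "integrable M m"
  shows "AE w in M. ereal_cond_exp M F f w =
    enn2ereal (nn_cond_exp M F (\<lambda>w. e2ennreal (f w - ereal (m w))) w) + ereal (real_cond_exp M F m w)"
proof -
  have [measurable]: "m \<in> borel_measurable M" using m by auto
  let ?p = "\<lambda>w. e2ennreal (f w - ereal (m w))"
  have 1: "AE w in M. ereal_cond_exp M F f w = enn2ereal (nn_cond_exp M F (\<lambda>w. ?p w + ennreal (m w)) w)
      - enn2ereal (nn_cond_exp M F (\<lambda>w. ennreal (- m w)) w)"
    using f integrable_neg_part(1)[OF m]
    by (intro ereal_cond_exp_diff) (auto elim!: eventually_mono intro: ennreal_parts_eq_lower)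
  have 2: "AE w in M. nn_cond_exp M F ?p w + nn_cond_exp M F (\<lambda>w. ennreal (m w)) w =
      nn_cond_exp M F (\<lambda>w. ?p w + ennreal (m w)) w"
    by (intro nn_cond_exp_sum) auto
  have 3: "AE w in M. nn_cond_exp M F (\<lambda>w. ennreal (m w)) w < top" "AE w in M. nn_cond_exp M F (\<lambda>w. ennreal (- m w)) w < top"
    using integrable_neg_part[OF m] by (auto intro!: nn_cond_exp_finite)
  show ?thesis using 1 2 3 ereal_real_cond_exp[OF m]
  proof eventually_elim
    case (elim w)
    then show ?case unfolding elim(1) elim(2)[symmetric] elim(5)
      by (cases "nn_cond_exp M F (\<lambda>w. ennreal (m w)) w" rule: ennreal_cases;
          cases "nn_cond_exp M F (\<lambda>w. ennreal (- m w)) w" rule: ennreal_cases;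
          cases "nn_cond_exp M F ?p w" rule: ennreal_cases)
         (auto simp: enn2ereal_ennreal plus_ennreal.rep_eq)
  qed
qed

end

section \<open>Conditional integrands\<close>

lemma lsc_on_diff_real: "lsc_on A f \<Longrightarrow> lsc_on A (\<lambda>x. f x - ereal c)"
  by (simp add: lsc_on_iff ereal_less_minus)

lemma lsc_env_add_real: "lsc_env (\<lambda>l. e l + ereal c) x = lsc_env e x + ereal c"
proof (rule antisym)
  show "lsc_env (\<lambda>l. e l + ereal c) x \<le> lsc_env e x + ereal c"
    by (intro lsc_env_least add_right_mono lsc_env_upper)
  have "lsc_env e x \<le> lsc_env (\<lambda>l. e l + ereal c) x - ereal c"
  proof (rule lsc_env_least)
    fix l assume "x \<in> cinter l"
    then have "e l + ereal c \<le> lsc_env (\<lambda>l. e l + ereal c) x" by (rule lsc_env_upper)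
    then show "e l \<le> lsc_env (\<lambda>l. e l + ereal c) x - ereal c" by (simp add: ereal_le_minus)
  qed
  then show "lsc_env e x + ereal c \<le> lsc_env (\<lambda>l. e l + ereal c) x" by (simp add: ereal_le_minus)
qed

lemma normal_integrand_compose:
  assumes "normal_integrand G k g" "x \<in> measurable G (borel_Rn k)"
  shows "(\<lambda>w. g (x w) w) \<in> borel_measurable G"
proof -
  have "(\<lambda>w. (x w, w)) \<in> measurable G (borel_Rn k \<Otimes>\<^sub>M G)"
    using assms(2) by (intro measurable_Pair) auto
  from measurable_compose[OF this, of "\<lambda>(x, w). g x w" borel] assms(1) show ?thesis
    by (simp add: normal_integrand_def)
qed

lemma finite_range_nbhd_index:
  "finite (range (nbhd_index j :: 'b::second_countable_topology \<Rightarrow> nat list))"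
proof (rule finite_subset)
  show "range (nbhd_index j :: 'b \<Rightarrow> nat list) \<subseteq> (\<lambda>S. filter (\<lambda>i. i \<in> S) [0..<j]) ` Pow {..<j}"
  proof
    fix l assume "l \<in> range (nbhd_index j :: 'b \<Rightarrow> nat list)"
    then obtain x :: 'b where l: "l = nbhd_index j x" by auto
    show "l \<in> (\<lambda>S. filter (\<lambda>i. i \<in> S) [0..<j]) ` Pow {..<j}"
      unfolding l nbhd_index_def
      by (rule image_eqI[of _ _ "{i. i < j \<and> x \<in> cbase i}"]) (auto intro: filter_cong)
  qed
qed auto

lemma measurable_nbhd_index:
  assumes x: "x \<in> borel_measurable M"
  shows "(\<lambda>w. nbhd_index j (x w)) \<in> measurable M (count_space UNIV)"
proof (induction j)
  case (Suc j)
  have [measurable]: "{w \<in> space M. x w \<in> cbase j} \<in> sets M"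
    using measurable_sets[OF x borel_open[OF open_cbase], of j] by (simp add: vimage_def Int_def conj_commute)
  have "(\<lambda>w. l @ (if x w \<in> cbase j then [j] else [])) \<in> measurable M (count_space UNIV)" for l
  proof -
    have "(\<lambda>w. if x w \<in> cbase j then l @ [j] else l) \<in> measurable M (count_space UNIV)" by (intro measurable_If) auto
    then show ?thesis by (simp add: if_distrib cong: if_cong)
  qed
  \<comment> \<open>The list at \<open>Suc j\<close> is the list at \<open>j\<close>, which has
    countably many possible values, followed by at most one entry.\<close>
  from measurable_compose_countable[OF this Suc]
  show ?case by (simp add: nbhd_index_def if_distrib cong: if_cong)
qed (simp add: nbhd_index_def)

text \<open>Null sets are put into \<open>F\<close> so that the restriction of \<open>M\<close> to
  \<open>F\<close> is complete. Projection and selection applied to this restriction give results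
  that are measurable for \<open>F\<close>.\<close>

locale complete_subalgebra = complete_finite_measure M + finite_measure_subalgebra M F for M F :: "'a measure" +
  assumes null_subset: "null_sets M \<subseteq> sets F"
begin

lemma space_F: "space F = space M" using subalg by (simp add: subalgebra_def)

lemma complete_finite_restr: "complete_finite_measure (restr_to_subalg M F)"
proof -
  have "complete_measure (restr_to_subalg M F)"
  proof
    fix A B :: "'a set" assume "B \<subseteq> A" "A \<in> null_sets (restr_to_subalg M F)"
    then have "B \<in> null_sets M" using complete2 by (auto simp: null_sets_restr_to_subalg[OF subalg])
    then show "B \<in> sets (restr_to_subalg M F)" using null_subset by (auto simp: sets_restr_to_subalg[OF subalg])
  qed
  moreover have "finite_measure (restr_to_subalg M F)"
    by (intro finite_measure_restr_to_subalg subalg) unfold_locales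
  ultimately show ?thesis by (rule complete_finite_measure.intro)
qed

lemma measurable_selection_F:
  assumes "A \<in> sets (borel_Rn k \<Otimes>\<^sub>M F)"
  shows "\<exists>s\<in>measurable F (borel_Rn k). AE w in M. w \<in> snd ` A \<longrightarrow> (s w, w) \<in> A"
proof -
  have eq: "measurable (restr_to_subalg M F) N = measurable F N" for N :: "'c measure"
    using sets_restr_to_subalg[OF subalg] by (rule measurable_cong_sets) simp
  have "sets (borel_Rn k \<Otimes>\<^sub>M restr_to_subalg M F) = sets (borel_Rn k \<Otimes>\<^sub>M F)"
    using sets_restr_to_subalg[OF subalg] by (intro sets_pair_measure_cong) auto
  with complete_finite_measure.measurable_selection[OF complete_finite_restr, of A k] assms
  show ?thesis by (auto simp: eq intro: AE_restr_to_subalg[OF subalg])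
qed

lemma measurable_INF_Rn_F:
  assumes "(\<lambda>(x, w). g x w) \<in> borel_measurable (borel_Rn k \<Otimes>\<^sub>M F)" and "U \<in> sets borel"
  shows "(\<lambda>w. INF x\<in>U \<inter> Rn k. g x w :: ereal) \<in> borel_measurable F"
proof -
  have "sets (borel_Rn k \<Otimes>\<^sub>M restr_to_subalg M F) = sets (borel_Rn k \<Otimes>\<^sub>M F)"
    using sets_restr_to_subalg[OF subalg] by (intro sets_pair_measure_cong) auto
  then have "(\<lambda>(x, w). g x w) \<in> borel_measurable (borel_Rn k \<Otimes>\<^sub>M restr_to_subalg M F)"
    using assms(1) by (simp cong: measurable_cong_sets)
  from complete_finite_measure.measurable_INF_Rn[OF complete_finite_restr this assms(2)]
  show ?thesis by (rule measurable_in_subalg'[OF subalg])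
qed

lemma AE_normal_integrand_compose:
  assumes "AE_normal_integrand M k g" and x: "x \<in> measurable M (borel_Rn k)"
  shows "(\<lambda>w. g (x w) w) \<in> borel_measurable M"
proof -
  obtain g' where g': "normal_integrand M k g'" "AE w in M. \<forall>x\<in>Rn k. g x w = g' x w"
    using assms(1) by (auto simp: AE_normal_integrand_def)
  have "AE w in M. g (x w) w = g' (x w) w"
    using g'(2) AE_space by eventually_elim (use measurable_borel_Rn_in[OF x] in auto)
  then show ?thesis by (rule borel_measurable_AE_eq[OF _ normal_integrand_compose[OF g'(1) x]])
qed

lemma AE_lower_compose:
  assumes "AE w in M. \<forall>x\<in>Rn k. ereal (m w) \<le> g x w" and x: "x \<in> measurable M (borel_Rn k)"
  shows "AE w in M. ereal (m w) \<le> g (x w) w"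
  using assms(1) AE_space by eventually_elim (use measurable_borel_Rn_in[OF x] in auto)

lemma expect_cond_integrand:
  assumes f: "is_cond_integrand M F k g f" and g: "AE_normal_integrand M k g"
    and m: "integrable M m" "AE w in M. \<forall>x\<in>Rn k. ereal (m w) \<le> g x w"
    and x: "x \<in> measurable F (borel_Rn k)"
  shows "expect M (\<lambda>w. f (x w) w) = expect M (\<lambda>w. g (x w) w)"
proof -
  have xM: "x \<in> measurable M (borel_Rn k)" using measurable_from_subalg[OF subalg x] .
  have "expect M (\<lambda>w. f (x w) w) = expect M (ereal_cond_exp M F (\<lambda>w. g (x w) w))"
    using f x by (intro expect_cong) (auto simp: is_cond_integrand_def)
  also have "\<dots> = expect M (\<lambda>w. g (x w) w)"
    using AE_lower_compose[OF m(2) xM] AE_normal_integrand_compose[OF g xM] m(1)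
    by (rule expect_ereal_cond_exp)
  finally show ?thesis .
qed

text \<open>For each inserted point the bound holds off a null set that depends on the point. To
  obtain one null set for all points, a violating point is selected measurably wherever one exists;
  the bound along this single selection excludes it almost surely.\<close>

lemma cond_integrand_lower_bound:
  assumes f: "is_cond_integrand M F k g f" and g: "AE_normal_integrand M k g"
    and m: "integrable M m" "AE w in M. \<forall>x\<in>Rn k. ereal (m w) \<le> g x w"
  shows "AE w in M. \<forall>x\<in>Rn k. ereal (real_cond_exp M F m w) \<le> f x w"
proof -
  define A where "A = {p \<in> space (borel_Rn k \<Otimes>\<^sub>M F).
      (case p of (x, w) \<Rightarrow> f x w) < ereal (real_cond_exp M F m (snd p))}"
  have [measurable]: "(\<lambda>(x, w). f x w) \<in> borel_measurable (borel_Rn k \<Otimes>\<^sub>M F)"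
    using f by (simp add: is_cond_integrand_def normal_integrand_def)
  have "A \<in> sets (borel_Rn k \<Otimes>\<^sub>M F)" unfolding A_def by measurable
  then obtain s where s: "s \<in> measurable F (borel_Rn k)" "AE w in M. w \<in> snd ` A \<longrightarrow> (s w, w) \<in> A"
    using measurable_selection_F by blast
  have sM: "s \<in> measurable M (borel_Rn k)" using measurable_from_subalg[OF subalg s(1)] .
  have 1: "AE w in M. f (s w) w = ereal_cond_exp M F (\<lambda>w. g (s w) w) w"
    using f s by (auto simp: is_cond_integrand_def)
  have 2: "AE w in M. ereal (real_cond_exp M F m w) \<le> ereal_cond_exp M F (\<lambda>w. g (s w) w) w"
    using AE_lower_compose[OF m(2) sM] AE_normal_integrand_compose[OF g sM] m(1)
    by (rule ereal_cond_exp_lower_bound)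
  show ?thesis using s(2) 1 2 AE_space
  proof eventually_elim
    case (elim w)
    then have "w \<notin> snd ` A" by (auto simp: A_def)
    then have "(x, w) \<notin> A" for x by force
    then show ?case using \<open>w \<in> space M\<close> by (auto simp: A_def space_pair_measure space_restrict_space space_F not_less)
  qed
qed

text \<open>The conditional integrand is the supremum over the basic open sets containing the point of the
  conditional expectations of the infimum of the integrand over the set. Monotone convergence along the
  decreasing neighbourhoods \<open>cinter (nbhd_index j (x w))\<close> shows that it is large enough.\<close>

lemma ex_cond_integrand:
  assumes g: "AE_normal_integrand M k g"
    and m: "integrable M m" "AE w in M. \<forall>x\<in>Rn k. ereal (m w) \<le> g x w"
  shows "\<exists>f. is_cond_integrand M F k g f"
proof -
  obtain g' where g': "normal_integrand M k g'" "AE w in M. \<forall>x\<in>Rn k. g x w = g' x w"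
    using g by (auto simp: AE_normal_integrand_def)
  have [measurable]: "m \<in> borel_measurable M" using m by auto
  have [measurable]: "(\<lambda>(x, w). g' x w) \<in> borel_measurable (borel_Rn k \<Otimes>\<^sub>M M)"
    using g'(1) by (simp add: normal_integrand_def)
  \<comment> \<open>The lower bound \<open>m\<close> is removed so that \<open>nn_cond_exp\<close>
    can be used; its conditional expectation is put back in the definition of
    \<open>f\<close>.\<close>
  define \<phi> where "\<phi> l w = (INF y\<in>cinter l \<inter> Rn k. g' y w - ereal (m w))" for l w
  have [measurable]: "\<phi> l \<in> borel_measurable M" for l
  proof -
    have "(\<lambda>(x, w). g' x w - ereal (m w)) = (\<lambda>p. (case p of (x, w) \<Rightarrow> g' x w) - ereal (m (snd p)))" by auto
    also have "\<dots> \<in> borel_measurable (borel_Rn k \<Otimes>\<^sub>M M)" by measurable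
    finally show ?thesis unfolding \<phi>_def by (rule measurable_INF_Rn) (simp add: borel_open open_cinter)
  qed
  define e where "e l = nn_cond_exp M F (\<lambda>w. e2ennreal (\<phi> l w))" for l
  have [measurable]: "e l \<in> borel_measurable F" for l by (simp add: e_def)
  define f where "f x w = lsc_env (\<lambda>l. enn2ereal (e l w) + ereal (real_cond_exp M F m w)) x"
    for x :: "nat \<Rightarrow> real" and w
  have "normal_integrand F k f" unfolding f_def by (rule normal_integrand_lsc_env) simp
  moreover have "AE w in M. f (x w) w = ereal_cond_exp M F (\<lambda>w. g (x w) w) w"
    if x: "x \<in> measurable F (borel_Rn k)" for x
  proof -
    have xM: "x \<in> measurable M (borel_Rn k)" using measurable_from_subalg[OF subalg x] .
    have xR: "x w \<in> Rn k" if "w \<in> space M" for w using measurable_borel_Rn_in[OF xM that] .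
    have xF: "x \<in> borel_measurable F" using x measurable_restrict_space2_iff by blast
    define \<gamma> where "\<gamma> w = e2ennreal (g' (x w) w - ereal (m w))" for w
    have [measurable]: "(\<lambda>w. g' (x w) w) \<in> borel_measurable M"
      by (rule normal_integrand_compose[OF g'(1) xM])
    have \<gamma>[measurable]: "\<gamma> \<in> borel_measurable M" unfolding \<gamma>_def by measurable
    define F0 where "F0 w = e2ennreal (lsc_env (\<lambda>l. enn2ereal (e l w)) (x w))" for w
    have "normal_integrand F k (\<lambda>x w. lsc_env (\<lambda>l. enn2ereal (e l w)) x)"
      by (rule normal_integrand_lsc_env) simp
    from normal_integrand_compose[OF this x] have [measurable]: "F0 \<in> borel_measurable F"
      unfolding F0_def by (rule measurable_compose[OF _ measurable_e2ennreal])
    have F0_ge: "e l w \<le> F0 w" if "x w \<in> cinter l" for l w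
      using e2ennreal_mono[OF lsc_env_upper[OF that, of "\<lambda>l. enn2ereal (e l w)"]] by (simp add: F0_def)

    \<comment> \<open>Where \<open>x w\<close> lies in \<open>cinter l\<close>, the infimum over
      \<open>cinter l\<close> is at most the value at \<open>x w\<close>. This event belongs to
      \<open>F\<close>, so its indicator passes through the conditional expectation.\<close>
    have "AE w in M. x w \<in> cinter l \<longrightarrow> e l w \<le> nn_cond_exp M F \<gamma> w" for l
    proof -
      define B where "B = {w \<in> space F. x w \<in> cinter l}"
      have B[measurable]: "B \<in> sets F"
        using measurable_sets[OF xF borel_open[OF open_cinter], of l] by (simp add: B_def vimage_def Int_def conj_commute)
      have [measurable]: "B \<in> sets M" using B subalg by (auto simp: subalgebra_def)
      have "AE w in M. nn_cond_exp M F (\<lambda>w. indicator B w * e2ennreal (\<phi> l w)) w \<le> nn_cond_exp M F \<gamma> w"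
      proof (rule nn_cond_exp_mono)
        show "AE w in M. indicator B w * e2ennreal (\<phi> l w) \<le> \<gamma> w"
        proof (rule AE_I2)
          fix w assume "w \<in> space M"
          show "indicator B w * e2ennreal (\<phi> l w) \<le> \<gamma> w"
          proof (cases "w \<in> B")
            case True
            then have "\<phi> l w \<le> g' (x w) w - ereal (m w)"
              unfolding \<phi>_def using xR[OF \<open>w \<in> space M\<close>] by (intro INF_lower) (auto simp: B_def)
            then show ?thesis using True by (simp add: \<gamma>_def e2ennreal_mono)
          qed simp
        qed
      qed auto
      moreover have "AE w in M. indicator B w * e l w = nn_cond_exp M F (\<lambda>w. indicator B w * e2ennreal (\<phi> l w)) w"
        unfolding e_def by (rule nn_cond_exp_prod) auto
      ultimately show ?thesis using AE_space
        by eventually_elim (auto simp: B_def space_F indicator_def)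
    qed
    then have "AE w in M. \<forall>l. x w \<in> cinter l \<longrightarrow> e l w \<le> nn_cond_exp M F \<gamma> w" by (simp add: AE_all_countable)
    then have le: "AE w in M. F0 w \<le> nn_cond_exp M F \<gamma> w"
    proof eventually_elim
      case (elim w)
      then have "lsc_env (\<lambda>l. enn2ereal (e l w)) (x w) \<le> enn2ereal (nn_cond_exp M F \<gamma> w)"
        by (intro lsc_env_least) (simp add: less_eq_ennreal.rep_eq)
      from e2ennreal_mono[OF this] show ?case by (simp add: F0_def)
    qed

    \<comment> \<open>The reverse inequality is proved in integrated form over sets of
      \<open>F\<close>, because monotone convergence is applied to infima over neighbourhoods that
      move with \<open>w\<close>.\<close>
    have ge: "(\<integral>\<^sup>+w\<in>B. \<gamma> w \<partial>M) \<le> (\<integral>\<^sup>+w\<in>B. F0 w \<partial>M)" if B[measurable]: "B \<in> sets F" for B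
    proof -
      have BM[measurable]: "B \<in> sets M" using B subalg by (auto simp: subalgebra_def)
      define \<gamma>j where "\<gamma>j j w = e2ennreal (\<phi> (nbhd_index j (x w)) w)" for j w
      have mono: "incseq (\<lambda>j. \<phi> (nbhd_index j (x w)) w)" for w
        unfolding \<phi>_def by (intro monoI INF_superset_mono) (use cinter_nbhd_index_antimono in blast)+
      have sup: "\<gamma> w = (SUP j. \<gamma>j j w)" if w: "w \<in> space M" for w
      proof -
        have "lsc_on (Rn k) (\<lambda>y. g' y w - ereal (m w))"
          using g'(1) w by (intro lsc_on_diff_real) (simp add: normal_integrand_def)
        from lsc_on_SUP_nbhd[OF this xR[OF w]]
        have "(SUP j. \<phi> (nbhd_index j (x w)) w) = g' (x w) w - ereal (m w)" by (simp add: \<phi>_def)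
        then show ?thesis
          using sup_continuousD[OF sup_continuous_e2ennreal[OF sup_continuous_id] mono, of w]
          by (simp add: \<gamma>_def \<gamma>j_def)
      qed
      have L[measurable]: "(\<lambda>w. nbhd_index j (x w)) \<in> measurable F (count_space UNIV)" for j
        by (rule measurable_nbhd_index[OF xF])
      have [measurable]: "(\<lambda>w. nbhd_index j (x w)) \<in> measurable M (count_space UNIV)" for j
        by (rule measurable_from_subalg[OF subalg L])
      have \<gamma>j_meas: "\<gamma>j j \<in> borel_measurable M" for j
        unfolding \<gamma>j_def by (rule measurable_compose_countable[where g = "\<lambda>w. nbhd_index j (x w)"]) auto
      have *: "(\<integral>\<^sup>+w\<in>B. \<gamma>j j w \<partial>M) \<le> (\<integral>\<^sup>+w\<in>B. F0 w \<partial>M)" for j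
      proof -
        \<comment> \<open>The moving neighbourhood takes finitely many values. On each event
          \<open>C l\<close> of \<open>F\<close> it is the fixed set \<open>cinter l\<close>, and
          there \<open>e l\<close> can be exchanged with the infimum under the integral.\<close>
        let ?\<Lambda> = "range (nbhd_index j :: (nat \<Rightarrow> real) \<Rightarrow> _)"
        define C where "C l = B \<inter> {w \<in> space F. nbhd_index j (x w) = l}" for l
        have [measurable]: "C l \<in> sets F" for l unfolding C_def by measurable
        have CM[measurable]: "C l \<in> sets M" for l using subalg \<open>C l \<in> sets F\<close> by (auto simp: subalgebra_def)
        have fin: "finite ?\<Lambda>" by (rule finite_range_nbhd_index)
        have split: "u (nbhd_index j (x w)) w * indicator B w = (\<Sum>l\<in>?\<Lambda>. indicator (C l) w * u l w)"
          if "w \<in> space M" for w and u :: "nat list \<Rightarrow> 'a \<Rightarrow> ennreal"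
        proof -
          have "(\<Sum>l\<in>?\<Lambda>. indicator (C l) w * u l w) =
              (\<Sum>l\<in>?\<Lambda>. if l = nbhd_index j (x w) then u l w * indicator B w else 0)"
            using that by (intro sum.cong) (auto simp: C_def space_F indicator_def)
          also have "\<dots> = u (nbhd_index j (x w)) w * indicator B w"
            using fin by (subst sum.delta) auto
          finally show ?thesis by simp
        qed
        have "(\<integral>\<^sup>+w\<in>B. \<gamma>j j w \<partial>M) = (\<integral>\<^sup>+w. (\<Sum>l\<in>?\<Lambda>. indicator (C l) w * e2ennreal (\<phi> l w)) \<partial>M)"
          unfolding \<gamma>j_def by (intro nn_integral_cong split)
        also have "\<dots> = (\<Sum>l\<in>?\<Lambda>. \<integral>\<^sup>+w. indicator (C l) w * e2ennreal (\<phi> l w) \<partial>M)"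
          by (intro nn_integral_sum) auto
        also have "\<dots> = (\<Sum>l\<in>?\<Lambda>. \<integral>\<^sup>+w. indicator (C l) w * e l w \<partial>M)"
          unfolding e_def by (intro sum.cong nn_cond_exp_intg[symmetric]) auto
        also have "\<dots> = (\<integral>\<^sup>+w. (\<Sum>l\<in>?\<Lambda>. indicator (C l) w * e l w) \<partial>M)"
          by (intro nn_integral_sum[symmetric]) (auto simp: e_def)
        also have "\<dots> = (\<integral>\<^sup>+w\<in>B. e (nbhd_index j (x w)) w \<partial>M)"
          by (intro nn_integral_cong split[symmetric])
        also have "\<dots> \<le> (\<integral>\<^sup>+w\<in>B. F0 w \<partial>M)"
          by (intro nn_integral_mono mult_right_mono F0_ge nbhd_index_mem) auto
        finally show ?thesis .
      qed
      have "(\<integral>\<^sup>+w\<in>B. \<gamma> w \<partial>M) = (\<integral>\<^sup>+w. (SUP j. \<gamma>j j w * indicator B w) \<partial>M)"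
        by (intro nn_integral_cong) (simp add: sup SUP_mult_right_ennreal)
      also have "\<dots> = (SUP j. \<integral>\<^sup>+w. \<gamma>j j w * indicator B w \<partial>M)"
      proof (rule nn_integral_monotone_convergence_SUP)
        show "incseq (\<lambda>j w. \<gamma>j j w * indicator B w)"
          using mono by (auto simp: \<gamma>j_def incseq_def le_fun_def intro!: mult_right_mono e2ennreal_mono)
        show "(\<lambda>w. \<gamma>j j w * indicator B w) \<in> borel_measurable M" for j using \<gamma>j_meas[of j] by measurable
      qed
      also have "\<dots> \<le> (\<integral>\<^sup>+w\<in>B. F0 w \<partial>M)" by (intro SUP_least *)
      finally show ?thesis .
    qed

    have F0M[measurable]: "F0 \<in> borel_measurable M" by (rule measurable_from_subalg[OF subalg]) simp
    have F0: "AE w in M. F0 w = nn_cond_exp M F \<gamma> w"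
    proof (rule nn_cond_exp_charact)
      fix B assume B[measurable]: "B \<in> sets F"
      have "(\<integral>\<^sup>+w\<in>B. F0 w \<partial>M) \<le> (\<integral>\<^sup>+w. indicator B w * nn_cond_exp M F \<gamma> w \<partial>M)"
        using le by (intro nn_integral_mono_AE) (auto elim!: eventually_mono simp: indicator_def)
      also have "\<dots> = (\<integral>\<^sup>+w. indicator B w * \<gamma> w \<partial>M)" by (rule nn_cond_exp_intg) auto
      finally show "(\<integral>\<^sup>+w\<in>B. \<gamma> w \<partial>M) = (\<integral>\<^sup>+w\<in>B. F0 w \<partial>M)"
        using ge[OF B] by (simp add: mult.commute)
    qed auto
    have gx: "(\<lambda>w. g (x w) w) \<in> borel_measurable M" by (rule AE_normal_integrand_compose[OF g xM])
    have shift: "AE w in M. ereal_cond_exp M F (\<lambda>w. g (x w) w) w =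
        enn2ereal (nn_cond_exp M F (\<lambda>w. e2ennreal (g (x w) w - ereal (m w))) w) + ereal (real_cond_exp M F m w)"
      using AE_lower_compose[OF m(2) xM] gx m(1) by (rule ereal_cond_exp_shift)
    have "AE w in M. g (x w) w = g' (x w) w"
      using g'(2) AE_space by eventually_elim (use xR in auto)
    then have "AE w in M. nn_cond_exp M F (\<lambda>w. e2ennreal (g (x w) w - ereal (m w))) w = nn_cond_exp M F \<gamma> w"
      using gx by (intro nn_cond_exp_cong) (auto simp: \<gamma>_def elim!: eventually_mono)
    with shift F0 show ?thesis
    proof eventually_elim
      case (elim w)
      \<comment> \<open>The empty list stands for the whole space, so the envelope is nonnegative
        and nothing was cut off by \<open>e2ennreal\<close> in \<open>F0\<close>.\<close>
      have "0 \<le> enn2ereal (e [] w)" by simp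
      also have "\<dots> \<le> lsc_env (\<lambda>l. enn2ereal (e l w)) (x w)" by (rule lsc_env_upper) (simp add: cinter_def)
      finally have "enn2ereal (F0 w) = lsc_env (\<lambda>l. enn2ereal (e l w)) (x w)"
        by (simp add: F0_def enn2ereal_e2ennreal)
      then show ?case using elim by (simp add: f_def lsc_env_add_real)
    qed
  qed
  ultimately show ?thesis by (auto simp: is_cond_integrand_def)
qed

end

section \<open>Partial minimization under the horizon condition\<close>

text \<open>The infimum over a shrinking neighbourhood grows as \<delta> decreases, so the limit in
  the definition exists and is a supremum over \<delta>. The tolerance \<delta> in the hypothesis
  disappears when the hypothesis is applied at a smaller radius.\<close>

lemma horizon_nonpos:
  assumes ex: "\<And>\<delta>. 0 < \<delta> \<Longrightarrow> \<exists>l\<in>{0<..<\<delta>}. \<exists>w'\<in>cball_Rn k w \<delta>. ereal l * f (\<lambda>i. w' i / l) \<le> ereal \<delta>"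
  shows "horizon k f w \<le> 0"
proof -
  define I where "I \<delta> = (INF (l, w') \<in> {0<..<\<delta>} \<times> cball_Rn k w \<delta>. ereal l * f (\<lambda>i. w' i / l))" for \<delta> :: real
  have anti: "I \<delta>' \<le> I \<delta>" if "\<delta> \<le> \<delta>'" for \<delta> \<delta>'
    unfolding I_def using that by (intro INF_superset_mono) (auto simp: cball_Rn_def)
  have le0: "I \<delta> \<le> 0" if "0 < \<delta>" for \<delta>
  proof (rule ccontr)
    assume "\<not> I \<delta> \<le> 0"
    then have "0 < I \<delta>" by simp
    then obtain \<eta> where "0 < ereal \<eta>" and less: "ereal \<eta> < I \<delta>" using ereal_dense2 by blast
    then have "0 < \<eta>" by simp
    then have "0 < min \<delta> \<eta>" using that by simp
    then obtain l w' where lw: "l \<in> {0<..<min \<delta> \<eta>}" "w' \<in> cball_Rn k w (min \<delta> \<eta>)"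
      "ereal l * f (\<lambda>i. w' i / l) \<le> ereal (min \<delta> \<eta>)" using ex by blast
    have "I \<delta> \<le> ereal l * f (\<lambda>i. w' i / l)"
      unfolding I_def by (rule INF_lower2[of "(l, w')"]) (use lw in \<open>auto simp: cball_Rn_def\<close>)
    also have "\<dots> \<le> ereal \<eta>" using lw(3) by (rule order_trans) simp
    finally show False using less by simp
  qed
  have "(I \<longlongrightarrow> (SUP \<delta>\<in>{0<..}. I \<delta>)) (at_right 0)"
  proof (rule order_tendstoI)
    fix a assume "a < (SUP \<delta>\<in>{0<..}. I \<delta>)"
    then obtain \<delta>0 where d: "0 < \<delta>0" "a < I \<delta>0" by (auto simp: less_SUP_iff)
    have "\<forall>\<^sub>F \<delta> in at_right 0. \<delta> < \<delta>0" using d(1) by (simp add: eventually_at_right_less eventually_at_right[of 0 \<delta>0] exI[of _ \<delta>0])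
    then show "\<forall>\<^sub>F \<delta> in at_right 0. a < I \<delta>"
      by eventually_elim (use d anti in \<open>meson less_imp_le less_le_trans\<close>)
  next
    fix a assume "(SUP \<delta>\<in>{0<..}. I \<delta>) < a"
    then have "I \<delta> < a" if "0 < \<delta>" for \<delta> using that by (meson SUP_lessD greaterThan_iff)
    then show "\<forall>\<^sub>F \<delta> in at_right 0. I \<delta> < a"
      by (auto simp: eventually_at_filter)
  qed
  then have "Lim (at_right 0) I = (SUP \<delta>\<in>{0<..}. I \<delta>)" by (intro tendsto_Lim) auto
  moreover have "horizon k f w = Lim (at_right 0) I" unfolding horizon_def I_def[abs_def] ..
  ultimately have "horizon k f w = (SUP \<delta>\<in>{0<..}. I \<delta>)" by simp
  then show ?thesis using le0 by (auto intro: SUP_least)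
qed

section \<open>Level sets, attainment and lower semicontinuity of partial infima\<close>

lemma tendsto_coord:
  fixes x :: "nat \<Rightarrow> nat \<Rightarrow> real"
  assumes "x \<longlonglongrightarrow> y" shows "(\<lambda>j. x j i) \<longlonglongrightarrow> y i"
  using continuous_on_tendsto_compose[OF continuous_on_product_coordinates[of i] assms] by simp

lemma tendsto_cat:
  assumes u: "u \<longlonglongrightarrow> u0" and v: "v \<longlonglongrightarrow> v0"
  shows "(\<lambda>j. cat K (u j) (v j)) \<longlonglongrightarrow> cat K u0 v0"
proof -
  have "continuous_on UNIV (\<lambda>p::(nat \<Rightarrow> real) \<times> (nat \<Rightarrow> real). cat K (fst p) (snd p))"
  proof (rule continuous_on_coordinatewise_then_product)
    fix i
    have 1: "continuous_on UNIV (\<lambda>p::(nat \<Rightarrow> real) \<times> (nat \<Rightarrow> real). fst p i)"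
      by (rule continuous_on_compose2[OF continuous_on_product_coordinates[of i]]) (auto intro: continuous_intros)
    have 2: "continuous_on UNIV (\<lambda>p::(nat \<Rightarrow> real) \<times> (nat \<Rightarrow> real). snd p (i - K))"
      by (rule continuous_on_compose2[OF continuous_on_product_coordinates[of "i - K"]]) (auto intro: continuous_intros)
    show "continuous_on UNIV (\<lambda>p::(nat \<Rightarrow> real) \<times> (nat \<Rightarrow> real). cat K (fst p) (snd p) i)"
      using 1 2 by (cases "i < K") (simp_all add: cat_def)
  qed
  from continuous_on_tendsto_compose[OF this tendsto_Pair[OF u v]] show ?thesis by simp
qed

lemma box_Rn_subsequence:
  fixes x :: "nat \<Rightarrow> nat \<Rightarrow> real"
  assumes "\<And>j. x j \<in> box_Rn k r"
  obtains y s where "y \<in> box_Rn k r" "strict_mono s" "(\<lambda>j. x (s j)) \<longlonglongrightarrow> y"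
  using seq_compactE[OF compact_imp_seq_compact[OF compact_box_Rn], of x k r] assms
  by (auto simp: o_def)

text \<open>Along an unbounded sequence in a level set, normalization of the last block would produce a
  direction along which the horizon function is nonpositive.\<close>

lemma level_bounded:
  assumes hor: "\<forall>v\<in>Rn d - {\<lambda>_. 0}. 0 < horizon (K + d) f (cat K (\<lambda>_. 0) v)"
  shows "\<exists>B. \<forall>z\<in>Rn (K + d). (\<forall>i<K. \<bar>z i\<bar> \<le> R) \<longrightarrow> f z \<le> ereal a \<longrightarrow> (\<Sum>i<d. \<bar>z (K + i)\<bar>) \<le> B"
proof (rule ccontr)
  assume "\<not> ?thesis"
  then have "\<forall>B. \<exists>z. z \<in> Rn (K + d) \<and> (\<forall>i<K. \<bar>z i\<bar> \<le> R) \<and> f z \<le> ereal a \<and> B < (\<Sum>i<d. \<bar>z (K + i)\<bar>)"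
    by (auto simp: not_le)
  then have "\<forall>j. \<exists>z. z \<in> Rn (K + d) \<and> (\<forall>i<K. \<bar>z i\<bar> \<le> R) \<and> f z \<le> ereal a \<and> real (Suc j) < (\<Sum>i<d. \<bar>z (K + i)\<bar>)"
    by blast
  then obtain z where z: "\<And>j. z j \<in> Rn (K + d)" "\<And>j i. i < K \<Longrightarrow> \<bar>z j i\<bar> \<le> R" "\<And>j. f (z j) \<le> ereal a"
    and big: "\<And>j. real (Suc j) < (\<Sum>i<d. \<bar>z j (K + i)\<bar>)"
    by metis
  \<comment> \<open>The last blocks are normalized by their sum norm; the lower bound
    \<open>Suc j\<close> keeps the divisor positive and drives it to infinity.\<close>
  define s where "s j = (\<Sum>i<d. \<bar>z j (K + i)\<bar>)" for j
  have s: "real (Suc j) < s j" for j using big by (simp add: s_def)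
  have s0: "0 < s j" for j using s[of j] by (rule less_trans[rotated]) simp
  have s_inf: "filterlim s at_top sequentially"
    using filterlim_real_sequentially
    by (rule filterlim_at_top_mono) (auto intro!: always_eventually order_trans[OF _ less_imp_le[OF s]])
  define v where "v j i = (if i < d then z j (K + i) / s j else 0)" for j i
  have sum_v: "(\<Sum>i<d. \<bar>v j i\<bar>) = 1" for j
  proof -
    have "(\<Sum>i<d. \<bar>v j i\<bar>) = (\<Sum>i<d. \<bar>z j (K + i)\<bar> / s j)"
      using s0[of j] by (intro sum.cong) (auto simp: v_def abs_divide)
    also have "\<dots> = s j / s j" unfolding sum_divide_distrib[symmetric] s_def[symmetric] ..
    finally show ?thesis using s0[of j] by simp
  qed
  have "v j \<in> box_Rn d 1" for j
  proof -
    have "\<bar>v j i\<bar> \<le> 1" if "i < d" for i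
      using member_le_sum[of i "{..<d}" "\<lambda>i. \<bar>v j i\<bar>"] that by (simp add: sum_v)
    then show ?thesis by (auto simp: box_Rn_def Rn_def v_def)
  qed
  then obtain v0 r where v0: "v0 \<in> box_Rn d 1" and r: "strict_mono r" and lim: "(\<lambda>j. v (r j)) \<longlonglongrightarrow> v0"
    by (rule box_Rn_subsequence)
  have "(\<lambda>j. \<Sum>i<d. \<bar>v (r j) i\<bar>) \<longlonglongrightarrow> (\<Sum>i<d. \<bar>v0 i\<bar>)"
    by (intro tendsto_sum tendsto_rabs tendsto_coord lim)
  \<comment> \<open>The sum norm is continuous, so the limit direction is nonzero and the horizon
    hypothesis applies to it.\<close>
  then have "(\<Sum>i<d. \<bar>v0 i\<bar>) = 1" by (simp add: sum_v LIMSEQ_const_iff)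
  then have "v0 \<noteq> (\<lambda>_. 0)" by auto
  moreover have "v0 \<in> Rn d" using v0 by (simp add: box_Rn_def)
  moreover have "horizon (K + d) f (cat K (\<lambda>_. 0) v0) \<le> 0"
  proof (rule horizon_nonpos)
    fix \<delta> :: real assume \<delta>: "0 < \<delta>"
    let ?w = "cat K (\<lambda>_. 0) v0"
    \<comment> \<open>With the scale \<open>1 / s (r j)\<close>, the point \<open>w' j\<close>
      divided by the scale is the original \<open>z (r j)\<close>. The first \<open>K\<close>
      coordinates are bounded by \<open>R\<close> and vanish after scaling, which explains the zero
      block of \<open>?w\<close>.\<close>
    define w' where "w' j i = z (r j) i / s (r j)" for j i
    have sr: "filterlim (\<lambda>j. s (r j)) at_top sequentially"
      by (rule filterlim_compose[OF s_inf filterlim_subseq[OF r]])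
    have inv: "(\<lambda>j. c / s (r j)) \<longlonglongrightarrow> 0" for c
      using tendsto_mult[OF tendsto_const[of c] tendsto_inverse_0_at_top[OF sr]] by (simp add: divide_inverse)
    have "(\<lambda>j. \<bar>w' j i - ?w i\<bar>) \<longlonglongrightarrow> 0" if "i < K + d" for i
    proof (cases "i < K")
      case True
      have "(\<lambda>j. w' j i) \<longlonglongrightarrow> 0"
      proof (rule Lim_null_comparison[OF always_eventually inv[of R]], rule allI)
        show "norm (w' j i) \<le> R / s (r j)" for j
          using z(2)[OF True, of "r j"] s0[of "r j"] by (simp add: w'_def abs_divide divide_right_mono)
      qed
      then show ?thesis using True by (simp add: cat_def tendsto_rabs_zero)
    next
      case False
      then have "w' j i = v (r j) (i - K)" for j using that by (auto simp: w'_def v_def)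
      moreover have "(\<lambda>j. \<bar>v (r j) (i - K) - v0 (i - K)\<bar>) \<longlonglongrightarrow> 0"
        using tendsto_coord[OF lim, of "i - K"] by (simp add: LIM_zero tendsto_rabs_zero)
      ultimately show ?thesis using False by (simp add: cat_def)
    qed
    then have "(\<lambda>j. \<Sum>i<K + d. \<bar>w' j i - ?w i\<bar>) \<longlonglongrightarrow> (\<Sum>i<K + d. 0)" by (intro tendsto_sum) auto
    then have "\<forall>\<^sub>F j in sequentially. (\<Sum>i<K + d. \<bar>w' j i - ?w i\<bar>) < \<delta>"
      using \<delta> by (intro order_tendstoD(2)) auto
    moreover have "\<forall>\<^sub>F j in sequentially. 1 / s (r j) < \<delta>" using inv[of 1] \<delta> by (rule order_tendstoD(2))
    moreover have "\<forall>\<^sub>F j in sequentially. \<bar>a\<bar> / s (r j) < \<delta>" using inv[of "\<bar>a\<bar>"] \<delta> by (rule order_tendstoD(2))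
    ultimately have "\<forall>\<^sub>F j in sequentially. (\<Sum>i<K + d. \<bar>w' j i - ?w i\<bar>) < \<delta> \<and> 1 / s (r j) < \<delta> \<and> \<bar>a\<bar> / s (r j) < \<delta>"
      by eventually_elim simp
    then obtain j where j: "(\<Sum>i<K + d. \<bar>w' j i - ?w i\<bar>) < \<delta>" "1 / s (r j) < \<delta>" "\<bar>a\<bar> / s (r j) < \<delta>"
      using eventually_happens by fastforce
    let ?l = "1 / s (r j)"
    have "w' j \<in> cball_Rn (K + d) ?w \<delta>"
      using z(1)[of "r j"] L2_set_le_sum_abs[of "\<lambda>i. w' j i - ?w i" "{..<K + d}"] j(1)
      by (auto simp: cball_Rn_def Rn_def w'_def)
    moreover have "ereal ?l * f (\<lambda>i. w' j i / ?l) \<le> ereal \<delta>"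
    proof -
      have "(\<lambda>i. w' j i / ?l) = z (r j)" using s0[of "r j"] by (auto simp: w'_def)
      then have "ereal ?l * f (\<lambda>i. w' j i / ?l) = ereal ?l * f (z (r j))" by simp
      also have "\<dots> \<le> ereal ?l * ereal \<bar>a\<bar>"
        using s0[of "r j"] z(3)[of "r j"] by (intro ereal_mult_left_mono) (auto intro: order_trans)
      also have "\<dots> \<le> ereal \<delta>" using j(3) by simp
      finally show ?thesis .
    qed
    ultimately show "\<exists>l\<in>{0<..<\<delta>}. \<exists>w'\<in>cball_Rn (K + d) ?w \<delta>. ereal l * f (\<lambda>i. w' i / l) \<le> ereal \<delta>"
      using j(2) s0[of "r j"] by (intro bexI[of _ ?l] bexI[of _ "w' j"]) auto
  qed
  ultimately show False using hor by (meson Diff_iff leD singletonD)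
qed

lemma lsc_on_sequentially:
  assumes f: "lsc_on A f" and z: "\<And>j. z j \<in> A" "z0 \<in> A" "z \<longlonglongrightarrow> z0"
    and c: "\<And>j. f (z j) \<le> c j" "c \<longlonglongrightarrow> c0"
  shows "f z0 \<le> c0"
proof (rule ccontr)
  assume "\<not> f z0 \<le> c0"
  then have "c0 < f z0" by simp
  then obtain y where y: "c0 < y" "y < f z0" using dense by blast
  then obtain U where U: "open U" "z0 \<in> U" "\<forall>z\<in>U \<inter> A. y < f z" using lsc_onD[OF f z(2)] by blast
  have "\<forall>\<^sub>F j in sequentially. z j \<in> U" using z(3) U by (auto dest: topological_tendstoD)
  moreover have "\<forall>\<^sub>F j in sequentially. c j < y" using order_tendstoD(2)[OF c(2) y(1)] .
  ultimately have "\<forall>\<^sub>F j::nat in sequentially. False"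
    by eventually_elim (use U z(1) c(1) in \<open>meson IntI leD less_trans not_le\<close>)
  then show False by simp
qed

text \<open>Common source of attainment, with \<open>u\<close> constant, and of lower
  semicontinuity, with \<open>u\<close> convergent. The first blocks are bounded and the values
  eventually stay below a real level, so level-boundedness confines the last blocks to a box, from
  which a convergent subsequence is drawn.\<close>

lemma minimizing_sequence_limit:
  assumes f: "lsc_on (Rn (K + d)) f"
    and hor: "\<forall>v\<in>Rn d - {\<lambda>_. 0}. 0 < horizon (K + d) f (cat K (\<lambda>_. 0) v)"
    and u: "u \<longlonglongrightarrow> u0" and v: "\<And>j. v j \<in> Rn d"
    and c: "\<And>j. f (cat K (u j) (v j)) \<le> c j" "c \<longlonglongrightarrow> c0" "c0 < \<infinity>"
  shows "\<exists>v0\<in>Rn d. f (cat K u0 v0) \<le> c0"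
proof -
  \<comment> \<open>The limit \<open>c0\<close> may be -\<infinity>; any real level above it
    captures a tail of the sequence.\<close>
  obtain a where a: "c0 < ereal a" using c(3) ereal_dense2 by blast
  have "\<forall>\<^sub>F j in sequentially. c j < ereal a" using order_tendstoD(2)[OF c(2) a] .
  then obtain N where N: "\<And>j. N \<le> j \<Longrightarrow> c j < ereal a" by (auto simp: eventually_sequentially)
  have "\<exists>R. \<forall>j. \<bar>u j i\<bar> \<le> R" for i
    using Bseq_bdd_above convergent_imp_Bseq[OF convergentI[OF tendsto_coord[OF u, of i]]]
    by (auto simp: Bseq_def)
  then obtain R where R: "\<And>i j. \<bar>u j i\<bar> \<le> R i" by metis
  have R': "\<bar>u j i\<bar> \<le> (\<Sum>i<K. \<bar>R i\<bar>)" if "i < K" for i j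
    using member_le_sum[of i "{..<K}" "\<lambda>i. \<bar>R i\<bar>"] that R[of j i] by fastforce
  obtain B where B: "\<And>z. z \<in> Rn (K + d) \<Longrightarrow> (\<forall>i<K. \<bar>z i\<bar> \<le> (\<Sum>i<K. \<bar>R i\<bar>)) \<Longrightarrow> f z \<le> ereal a \<Longrightarrow> (\<Sum>i<d. \<bar>z (K + i)\<bar>) \<le> B"
    using level_bounded[OF hor] by blast
  have "v (j + N) \<in> box_Rn d B" for j
  proof -
    let ?z = "cat K (u (j + N)) (v (j + N))"
    have "(\<Sum>i<d. \<bar>?z (K + i)\<bar>) \<le> B"
      using R' c(1)[of "j + N"] N[of "j + N"] by (intro B cat_in_Rn v) (auto simp: cat_def intro: order_trans less_imp_le)
    then have "(\<Sum>i<d. \<bar>v (j + N) i\<bar>) \<le> B" by (simp add: cat_def)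
    moreover have "\<bar>v (j + N) i\<bar> \<le> (\<Sum>i<d. \<bar>v (j + N) i\<bar>)" if "i < d" for i
      using member_le_sum[of i "{..<d}" "\<lambda>i. \<bar>v (j + N) i\<bar>"] that by simp
    ultimately show ?thesis using v by (fastforce simp: box_Rn_def)
  qed
  then obtain v0 r where v0: "v0 \<in> box_Rn d B" and r: "strict_mono r" and lim: "(\<lambda>j. v (r j + N)) \<longlonglongrightarrow> v0"
    by (rule box_Rn_subsequence)
  have "filterlim (\<lambda>j. r j + N) sequentially sequentially"
    by (rule filterlim_compose[OF filterlim_add_const_nat_at_top filterlim_subseq[OF r]])
  then have "(\<lambda>j. u (r j + N)) \<longlonglongrightarrow> u0" "(\<lambda>j. c (r j + N)) \<longlonglongrightarrow> c0"
    using filterlim_compose[OF u] filterlim_compose[OF c(2)] by auto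
  moreover have v0R: "v0 \<in> Rn d" using v0 by (simp add: box_Rn_def)
  ultimately have "f (cat K u0 v0) \<le> c0"
    using lsc_on_sequentially[OF f, of "\<lambda>j. cat K (u (r j + N)) (v (r j + N))" "cat K u0 v0" "\<lambda>j. c (r j + N)" c0]
      v c(1) lim by (simp add: cat_in_Rn tendsto_cat)
  then show ?thesis using v0R by blast
qed

lemma partial_min_attained:
  assumes f: "lsc_on (Rn (K + d)) f"
    and hor: "\<forall>v\<in>Rn d - {\<lambda>_. 0}. 0 < horizon (K + d) f (cat K (\<lambda>_. 0) v)"
  shows "\<exists>v0\<in>Rn d. f (cat K u v0) \<le> (INF v\<in>Rn d. f (cat K u v))"
proof (cases "(INF v\<in>Rn d. f (cat K u v)) < \<infinity>")
  case True
  then obtain c where c: "\<And>j. (INF v\<in>Rn d. f (cat K u v)) < c j" "c \<longlonglongrightarrow> (INF v\<in>Rn d. f (cat K u v))"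
    using approx_from_above_dense_linorder[OF True] by blast
  have "\<exists>v\<in>Rn d. f (cat K u v) < c j" for j using c(1)[of j] by (simp add: INF_less_iff)
  then obtain v where "\<And>j. v j \<in> Rn d" "\<And>j. f (cat K u (v j)) < c j" by metis
  then show ?thesis
    using minimizing_sequence_limit[OF f hor tendsto_const[of u] _ _ c(2) True, of v] less_imp_le by blast
next
  case False
  \<comment> \<open>If the infimum is \<infinity>, every point is a minimizer, for instance the
    origin.\<close>
  then show ?thesis by (intro bexI[of _ "\<lambda>_. 0"]) (auto simp: Rn_def)
qed

text \<open>Minimizers chosen along a sequence approaching \<open>u\<close> accumulate at a point
  that witnesses the bound at \<open>u\<close>. Sequences suffice because the sequence space is
  first countable.\<close>

lemma partial_min_lsc:
  assumes f: "lsc_on (Rn (K + d)) f"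
    and hor: "\<forall>v\<in>Rn d - {\<lambda>_. 0}. 0 < horizon (K + d) f (cat K (\<lambda>_. 0) v)"
  shows "lsc_on (Rn K) (\<lambda>u. INF v\<in>Rn d. f (cat K u v))"
  unfolding lsc_on_iff
proof (intro ballI allI impI, rule ccontr)
  fix u y assume "u \<in> Rn K" and y: "y < (INF v\<in>Rn d. f (cat K u v))"
    and no: "\<not> (\<exists>U. open U \<and> u \<in> U \<and> (\<forall>z\<in>U \<inter> Rn K. y < (INF v\<in>Rn d. f (cat K z v))))"
  obtain A where A: "\<And>i. open (A i)" "\<And>i. u \<in> A i" "\<And>F. (\<forall>n. F n \<in> A n) \<Longrightarrow> F \<longlonglongrightarrow> u"
    using first_countable_topology_class.countable_basis[of u] by blast
  have "\<exists>z\<in>A j \<inter> Rn K. (INF v\<in>Rn d. f (cat K z v)) \<le> y" for j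
    using no A(1,2)[of j] by (auto simp: not_less)
  then obtain z where z: "\<And>j. z j \<in> A j" "\<And>j. (INF v\<in>Rn d. f (cat K (z j) v)) \<le> y" by (metis IntD1)
  have "\<exists>v\<in>Rn d. f (cat K (z j) v) \<le> y" for j
    using partial_min_attained[OF f hor, of "z j"] z(2)[of j] order_trans by blast
  then obtain v where v: "\<And>j. v j \<in> Rn d" "\<And>j. f (cat K (z j) (v j)) \<le> y" by metis
  have "z \<longlonglongrightarrow> u" using A(3) z(1) by blast
  moreover have "y < \<infinity>" using y by (auto intro: less_le_trans)
  ultimately obtain v0 where "v0 \<in> Rn d" "f (cat K u v0) \<le> y"
    using minimizing_sequence_limit[OF f hor, of z u v "\<lambda>_. y" y] v by auto
  then have "(INF v\<in>Rn d. f (cat K u v)) \<le> y" by (meson INF_lower2)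
  then show False using y by simp
qed

lemma cat_split:
  assumes "z \<in> Rn (K + d)"
  shows "\<exists>u\<in>Rn K. \<exists>v\<in>Rn d. z = cat K u v \<and> proj_Rn K z = u"
proof (intro bexI conjI)
  show "z = cat K (proj_Rn K z) (\<lambda>i. z (K + i))" by (auto simp: cat_def proj_Rn_def)
qed (use assms in \<open>auto simp: Rn_def proj_Rn_def\<close>)

lemma proj_Rn_cat: "u \<in> Rn K \<Longrightarrow> proj_Rn K (cat K u v) = u"
  by (auto simp: proj_Rn_def cat_def Rn_def)

context complete_subalgebra
begin

text \<open>Lower semicontinuity of the partial infimum is known for those \<open>w\<close> at which
  the horizon condition holds. The envelope of its infima over basic open sets is normal for all
  \<open>w\<close> and agrees with it at these.\<close>

lemma AE_normal_integrand_partial_min: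
  assumes f: "normal_integrand F (K + d) f"
    and hor: "AE w in M. \<forall>v\<in>Rn d - {\<lambda>_. 0}. 0 < horizon (K + d) (\<lambda>z. f z w) (cat K (\<lambda>_. 0) v)"
  shows "AE_normal_integrand M K (\<lambda>u w. INF v\<in>Rn d. f (cat K u v) w)"
  unfolding AE_normal_integrand_def
proof (intro exI conjI)
  define e where "e l w = (INF u\<in>cinter l \<inter> Rn K. INF v\<in>Rn d. f (cat K u v) w)" for l w
  \<comment> \<open>The iterated infimum becomes a single one over the joint space, to which
    measurability of infima applies; the restriction on the first block is a Borel condition through
    \<open>proj_Rn\<close>.\<close>
  have eq: "e l w = (INF z\<in>{z. proj_Rn K z \<in> cinter l} \<inter> Rn (K + d). f z w)" for l w
  proof (rule antisym)
    show "e l w \<le> (INF z\<in>{z. proj_Rn K z \<in> cinter l} \<inter> Rn (K + d). f z w)"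
    proof (rule INF_greatest)
      fix z assume z: "z \<in> {z. proj_Rn K z \<in> cinter l} \<inter> Rn (K + d)"
      then obtain u v where "u \<in> Rn K" "v \<in> Rn d" "z = cat K u v" "proj_Rn K z = u" using cat_split by blast
      then show "e l w \<le> f z w" unfolding e_def using z by (intro INF_lower2[of u] INF_lower2[of v]) auto
    qed
    show "(INF z\<in>{z. proj_Rn K z \<in> cinter l} \<inter> Rn (K + d). f z w) \<le> e l w"
      unfolding e_def by (intro INF_greatest INF_lower) (auto simp: proj_Rn_cat cat_in_Rn)
  qed
  have "e l \<in> borel_measurable M" for l
  proof (rule measurable_from_subalg[OF subalg])
    have "proj_Rn K \<in> borel_measurable borel" using measurable_proj_Rn measurable_restrict_space2_iff by blast
    from measurable_sets[OF this borel_open[OF open_cinter], of l]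
    have "{z. proj_Rn K z \<in> cinter l} \<in> sets borel" by (simp add: vimage_def)
    then show "e l \<in> borel_measurable F"
      unfolding eq using f by (intro measurable_INF_Rn_F) (auto simp: normal_integrand_def)
  qed
  then show "normal_integrand M K (\<lambda>u w. lsc_env (\<lambda>l. e l w) u)" by (rule normal_integrand_lsc_env)
  show "AE w in M. \<forall>u\<in>Rn K. (INF v\<in>Rn d. f (cat K u v) w) = lsc_env (\<lambda>l. e l w) u"
    using hor AE_space
  proof eventually_elim
    case (elim w)
    then have "lsc_on (Rn (K + d)) (\<lambda>z. f z w)" using f by (simp add: normal_integrand_def space_F)
    from lsc_on_eq_lsc_env[OF partial_min_lsc[OF this elim(1)]] show ?case by (simp add: e_def)
  qed
qed

lemma argmin_selection:
  assumes f: "normal_integrand F (K + d) f"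
    and hor: "AE w in M. \<forall>v\<in>Rn d - {\<lambda>_. 0}. 0 < horizon (K + d) (\<lambda>z. f z w) (cat K (\<lambda>_. 0) v)"
    and u: "u \<in> measurable F (borel_Rn K)"
  shows "\<exists>s\<in>measurable F (borel_Rn d). AE w in M. is_arg_min (\<lambda>v. f (cat K (u w) v) w) (\<lambda>v. v \<in> Rn d) (s w)"
proof -
  define g where "g v w = f (cat K (u w) v) w" for v w
  have cat: "(\<lambda>p. cat K (u (snd p)) (fst p)) \<in> measurable (borel_Rn d \<Otimes>\<^sub>M F) (borel_Rn (K + d))"
  proof (rule measurable_borel_RnI)
    fix i
    have [measurable]: "(\<lambda>w. u w i) \<in> borel_measurable F" by (rule measurable_borel_Rn_coord[OF u])
    have [measurable]: "(\<lambda>v. v (i - K)) \<in> borel_measurable (borel_Rn d)"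
      by (rule measurable_restrict_space1) (rule measurable_coord)
    show "(\<lambda>p. cat K (u (snd p)) (fst p) i) \<in> borel_measurable (borel_Rn d \<Otimes>\<^sub>M F)"
      by (cases "i < K") (simp_all add: cat_def)
  qed (auto simp: space_pair_measure space_restrict_space intro!: cat_in_Rn)
  have "(\<lambda>p. (cat K (u (snd p)) (fst p), snd p)) \<in> measurable (borel_Rn d \<Otimes>\<^sub>M F) (borel_Rn (K + d) \<Otimes>\<^sub>M F)"
    using cat by (intro measurable_Pair) auto
  from measurable_compose[OF this, of "\<lambda>(z, w). f z w" borel] f
  have g[measurable]: "(\<lambda>(v, w). g v w) \<in> borel_measurable (borel_Rn d \<Otimes>\<^sub>M F)"
    by (simp add: normal_integrand_def g_def split_beta)
  have [measurable]: "(\<lambda>w. INF v\<in>Rn d. g v w) \<in> borel_measurable F"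
    using measurable_INF_Rn_F[OF g, of UNIV] by simp
  \<comment> \<open>The graph of the argmin mapping: a value not above the infimum is minimal. Both
    sides are measurable for \<open>F\<close>, hence so is the selection.\<close>
  define A where "A = {p \<in> space (borel_Rn d \<Otimes>\<^sub>M F). (case p of (v, w) \<Rightarrow> g v w) \<le> (INF v\<in>Rn d. g v (snd p))}"
  have "A \<in> sets (borel_Rn d \<Otimes>\<^sub>M F)" unfolding A_def by measurable
  then obtain s where s: "s \<in> measurable F (borel_Rn d)" "AE w in M. w \<in> snd ` A \<longrightarrow> (s w, w) \<in> A"
    using measurable_selection_F by blast
  have "AE w in M. is_arg_min (\<lambda>v. f (cat K (u w) v) w) (\<lambda>v. v \<in> Rn d) (s w)"
    using hor AE_space s(2)
  proof eventually_elim
    case (elim w)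
    then have "lsc_on (Rn (K + d)) (\<lambda>z. f z w)" using f by (simp add: normal_integrand_def space_F)
    from partial_min_attained[OF this elim(1), of "u w"]
    obtain v0 where "v0 \<in> Rn d" "g v0 w \<le> (INF v\<in>Rn d. g v w)" by (auto simp: g_def)
    then have "(v0, w) \<in> A" using elim(2) by (simp add: A_def space_pair_measure space_restrict_space space_F)
    then have "(s w, w) \<in> A" using elim(3) by force
    then have "s w \<in> Rn d" "g (s w) w \<le> (INF v\<in>Rn d. g v w)"
      by (auto simp: A_def space_pair_measure space_restrict_space)
    then show ?case by (auto simp: is_arg_min_def g_def not_less intro: order_trans INF_lower)
  qed
  with s(1) show ?thesis by blast
qed

end

section \<open>Dynamic programming\<close>

lemma total_dim_Suc: "total_dim n (Suc t) = total_dim n t + n t"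
  by (simp add: total_dim_def)

lemma hist_cong: "(\<And>s. s < t \<Longrightarrow> x s = y s) \<Longrightarrow> hist n x t w = hist n y t w"
  by (induction t) auto

lemma measurable_cat:
  assumes u: "u \<in> measurable G (borel_Rn K)" and v: "v \<in> measurable G (borel_Rn d)"
  shows "(\<lambda>w. cat K (u w) (v w)) \<in> measurable G (borel_Rn (K + d))"
proof (rule measurable_borel_RnI)
  show "(\<lambda>w. cat K (u w) (v w) i) \<in> borel_measurable G" for i
    using measurable_borel_Rn_coord[OF u] measurable_borel_Rn_coord[OF v]
    by (cases "i < K") (simp_all add: cat_def)
qed (intro cat_in_Rn measurable_borel_Rn_in[OF v])

lemma measurable_hist:
  "(\<And>s. s < t \<Longrightarrow> x s \<in> measurable G (borel_Rn (n s))) \<Longrightarrow> hist n x t \<in> measurable G (borel_Rn (total_dim n t))"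
proof (induction t)
  case 0
  show ?case by (rule measurable_borel_RnI) (auto simp: Rn_def)
next
  case (Suc t)
  then show ?case using measurable_cat[of "hist n x t" G "total_dim n t" "x t" "n t"]
    by (simp add: total_dim_Suc)
qed

section \<open>The backward recursion\<close>

locale stochastic_program =
  fixes M :: "'a measure" and F :: "nat \<Rightarrow> 'a measure" and T :: nat and n :: "nat \<Rightarrow> nat"
    and h :: "(nat \<Rightarrow> real) \<Rightarrow> 'a \<Rightarrow> ereal" and m :: "'a \<Rightarrow> real"
  assumes filtered: "complete_filtered_prob_space M F T"
    and normal: "normal_integrand M (total_dim n (Suc T)) h"
    and int_m: "integrable M m"
    and lower: "AE w in M. \<forall>x\<in>Rn (total_dim n (Suc T)). ereal (m w) \<le> h x w"
    and horizon_pos: "\<And>t. t \<le> T \<Longrightarrow> well_defined M F n T h t \<Longrightarrow>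
           AE w in M. \<forall>v\<in>Rn (n t) - {\<lambda>_. 0}.
             0 < horizon (total_dim n (Suc t)) (\<lambda>z. hcond M F n T h t z w) (cat (total_dim n t) (\<lambda>_. 0) v)"
begin

abbreviation "D \<equiv> total_dim n"
abbreviation "hc \<equiv> hcond M F n T h"
abbreviation "ht \<equiv> htilde M F n T h"

lemma complete_subalgebra: "t \<le> T \<Longrightarrow> complete_subalgebra M (F t)"
proof -
  assume t: "t \<le> T"
  interpret prob_space M using filtered by (simp add: complete_filtered_prob_space_def)
  have c: "complete_measure M" "subalgebra M (F t)" "subalgebra (F t) (F 0)" "null_sets M \<subseteq> sets (F 0)"
    using filtered t by (auto simp: complete_filtered_prob_space_def)
  then have "null_sets M \<subseteq> sets (F t)" by (auto simp: subalgebra_def)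
  with c show ?thesis
    by (intro complete_subalgebra.intro complete_finite_measure.intro finite_measure_subalgebra.intro
        finite_measure_subalgebra_axioms.intro complete_subalgebra_axioms.intro finite_measure_axioms)
qed

lemma measurable_F_mono: "s \<le> t \<Longrightarrow> t \<le> T \<Longrightarrow> f \<in> measurable (F s) N \<Longrightarrow> f \<in> measurable (F t) N"
  using filtered by (auto simp: complete_filtered_prob_space_def intro: measurable_from_subalg)

lemma measurable_F_M: "t \<le> T \<Longrightarrow> f \<in> measurable (F t) N \<Longrightarrow> f \<in> measurable M N"
  using filtered by (auto simp: complete_filtered_prob_space_def intro: measurable_from_subalg)

lemma space_F: "t \<le> T \<Longrightarrow> space (F t) = space M"
  using filtered by (auto simp: complete_filtered_prob_space_def subalgebra_def)

lemma well_definedD: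
  assumes "t \<le> T" "well_defined M F n T h t"
  shows "AE_normal_integrand M (D (Suc t)) (ht t)" "integrably_bounded_below M (D (Suc t)) (ht t)"
    "\<exists>f. is_cond_integrand M (F t) (D (Suc t)) (ht t) f"
  using assms by (auto simp: well_defined_def)

lemma hcond_cond_integrand:
  assumes "t \<le> T" "well_defined M F n T h t"
  shows "is_cond_integrand M (F t) (D (Suc t)) (ht t) (hc t)"
  unfolding hcond_def cond_integrand_def by (rule someI_ex[OF well_definedD(3)[OF assms]])

lemma hcond_lower_bound:
  assumes t: "t \<le> T" "well_defined M F n T h t"
  shows "\<exists>\<mu>. integrable M \<mu> \<and> (AE w in M. \<forall>x\<in>Rn (D (Suc t)). ereal (\<mu> w) \<le> hc t x w)"
proof -
  interpret complete_subalgebra M "F t" using complete_subalgebra t by simp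
  obtain m' where m': "integrable M m'" "AE w in M. \<forall>x\<in>Rn (D (Suc t)). ereal (m' w) \<le> ht t x w"
    using well_definedD(2)[OF t] unfolding integrably_bounded_below_def by blast
  moreover note well_definedD(1)[OF t]
  ultimately show ?thesis
    using cond_integrand_lower_bound[OF hcond_cond_integrand[OF t]] real_cond_exp_int(1) by blast
qed

text \<open>For \<open>0 < t \<le> T\<close> this is \<open>ht (t - 1)\<close>. The index is moved
  by one to include \<open>t = 0\<close>, where the history is void and \<open>ht\<close> has no
  counterpart.\<close>

definition stage_min :: "nat \<Rightarrow> (nat \<Rightarrow> real) \<Rightarrow> 'a \<Rightarrow> ereal" where
  "stage_min t u w = (INF v\<in>Rn (n t). hc t (cat (D t) u v) w)"

lemma htilde_eq_stage_min: "Suc t \<le> T \<Longrightarrow> ht t = stage_min (Suc t)"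
  by (intro ext) (simp add: stage_min_def htilde_step)

lemma stage_min_normal:
  assumes t: "t \<le> T" "well_defined M F n T h t"
  shows "AE_normal_integrand M (D t) (stage_min t)"
proof -
  interpret complete_subalgebra M "F t" using complete_subalgebra t by simp
  have "normal_integrand (F t) (D t + n t) (hc t)"
    using hcond_cond_integrand[OF t] by (simp add: is_cond_integrand_def total_dim_Suc)
  from AE_normal_integrand_partial_min[OF this] horizon_pos[OF t]
  show ?thesis by (simp add: stage_min_def[abs_def] total_dim_Suc)
qed

lemma stage_min_lower_bound:
  assumes t: "t \<le> T" "well_defined M F n T h t"
  shows "integrably_bounded_below M (D t) (stage_min t)"
proof -
  obtain \<mu> where \<mu>: "integrable M \<mu>" "AE w in M. \<forall>x\<in>Rn (D (Suc t)). ereal (\<mu> w) \<le> hc t x w"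
    using hcond_lower_bound[OF t] by blast
  have "AE w in M. \<forall>u\<in>Rn (D t). ereal (\<mu> w) \<le> stage_min t u w"
    using \<mu>(2) by eventually_elim (auto simp: stage_min_def total_dim_Suc intro!: INF_greatest cat_in_Rn)
  with \<mu>(1) show ?thesis by (auto simp: integrably_bounded_below_def)
qed

text \<open>The horizon hypothesis at a stage presupposes well-definedness there, so the induction
  runs backward: stage \<open>Suc t\<close> releases the hypothesis, which makes \<open>ht t\<close>
  normal up to a null set; the integrable lower bound is inherited, and the conditional integrand at
  \<open>t\<close> exists.\<close>

lemma well_defined:
  assumes "t \<le> T" shows "well_defined M F n T h t"
  using assms
proof (induction rule: inc_induct)
  case base
  interpret complete_subalgebra M "F T" using complete_subalgebra by simp
  have "AE_normal_integrand M (D (Suc T)) h" using normal by (auto simp: AE_normal_integrand_def)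
  moreover have "integrably_bounded_below M (D (Suc T)) h"
    using int_m lower by (auto simp: integrably_bounded_below_def)
  ultimately show ?case
    using ex_cond_integrand[of "D (Suc T)" h] int_m lower by (auto simp: well_defined_def htilde_T)
next
  case (step t)
  interpret complete_subalgebra M "F t" using complete_subalgebra step by simp
  have St: "Suc t \<le> T" using step by simp
  have 1: "AE_normal_integrand M (D (Suc t)) (ht t)"
    using stage_min_normal[OF St step.IH] htilde_eq_stage_min[OF St] by simp
  have 2: "integrably_bounded_below M (D (Suc t)) (ht t)"
    using stage_min_lower_bound[OF St step.IH] htilde_eq_stage_min[OF St] by simp
  then obtain m' where "integrable M m'" "AE w in M. \<forall>x\<in>Rn (D (Suc t)). ereal (m' w) \<le> ht t x w"
    by (auto simp: integrably_bounded_below_def)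
  then have 3: "\<exists>f. is_cond_integrand M (F t) (D (Suc t)) (ht t) f" by (rule ex_cond_integrand[OF 1])
  have "{t..T} = insert t {Suc t..T}" using step by auto
  then show ?case using 1 2 3 step.IH by (simp add: well_defined_def)
qed

section \<open>Values along a strategy\<close>

definition V :: "nat \<Rightarrow> (nat \<Rightarrow> 'a \<Rightarrow> nat \<Rightarrow> real) \<Rightarrow> ereal" where
  "V t x = expect M (\<lambda>w. hc t (hist n x (Suc t) w) w)"

text \<open>The value if the blocks before \<open>t\<close> follow \<open>x\<close> and block
  \<open>t\<close> is minimized. For adapted \<open>x\<close> it interlaces with \<open>V\<close>:
  \<open>W t x \<le> V t x\<close>, and \<open>V t x = W (Suc t) x\<close> as long as
  \<open>t < T\<close>.\<close>

definition W :: "nat \<Rightarrow> (nat \<Rightarrow> 'a \<Rightarrow> nat \<Rightarrow> real) \<Rightarrow> ereal" where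
  "W t x = expect M (\<lambda>w. stage_min t (hist n x t w) w)"

text \<open>With void history this number depends on no strategy, which makes it a lower bound for
  all of them; it turns out to be the infimum of the problem.\<close>

definition W0 :: ereal where
  "W0 = expect M (\<lambda>w. stage_min 0 (\<lambda>_. 0) w)"

lemma W_0: "W 0 x = W0" by (simp add: W_def W0_def)

lemma hist_measurable:
  assumes "x \<in> adapted F n T" "t \<le> T" "s \<le> Suc t"
  shows "hist n x s \<in> measurable (F t) (borel_Rn (D s))"
proof (rule measurable_hist)
  fix r assume "r < s"
  then show "x r \<in> measurable (F t) (borel_Rn (n r))"
    using assms by (intro measurable_F_mono[of r t]) (auto simp: adapted_def)
qed

lemma adapted_in_Rn: "x \<in> adapted F n T \<Longrightarrow> t \<le> T \<Longrightarrow> w \<in> space M \<Longrightarrow> x t w \<in> Rn (n t)"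
  using measurable_borel_Rn_in[of "x t" "F t" "n t" w] by (simp add: adapted_def space_F)

lemma tower:
  assumes x: "x \<in> adapted F n T" and t: "t \<le> T"
  shows "V t x = expect M (\<lambda>w. ht t (hist n x (Suc t) w) w)"
proof -
  interpret complete_subalgebra M "F t" using complete_subalgebra t by simp
  note wd = well_defined[OF t]
  obtain m' where m': "integrable M m'" "AE w in M. \<forall>x\<in>Rn (D (Suc t)). ereal (m' w) \<le> ht t x w"
    using well_definedD(2)[OF t wd] unfolding integrably_bounded_below_def by blast
  from expect_cond_integrand[OF hcond_cond_integrand[OF t wd] well_definedD(1)[OF t wd] m' hist_measurable[OF x t order_refl]]
  show ?thesis by (simp add: V_def)
qed

lemma V_T: "x \<in> adapted F n T \<Longrightarrow> V T x = expect M (\<lambda>w. h (hist n x (Suc T) w) w)"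
  by (simp add: tower htilde_T)

lemma W_Suc: "x \<in> adapted F n T \<Longrightarrow> Suc t \<le> T \<Longrightarrow> W (Suc t) x = V t x"
  by (simp add: tower W_def htilde_eq_stage_min)

lemma stage_min_le: "x \<in> adapted F n T \<Longrightarrow> t \<le> T \<Longrightarrow> w \<in> space M \<Longrightarrow>
    stage_min t (hist n x t w) w \<le> hc t (hist n x (Suc t) w) w"
  by (auto simp: stage_min_def intro!: INF_lower adapted_in_Rn)

lemma W_le_V: "x \<in> adapted F n T \<Longrightarrow> t \<le> T \<Longrightarrow> W t x \<le> V t x"
  unfolding W_def V_def by (intro expect_mono AE_I2 stage_min_le)

lemma W0_le_V: "x \<in> adapted F n T \<Longrightarrow> t \<le> T \<Longrightarrow> W0 \<le> V t x"
proof (induction t)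
  case 0 then show ?case using W_le_V[of x 0] by (simp add: W_0)
next
  case (Suc t) then show ?case using W_le_V[of x "Suc t"] W_Suc[of x t] by simp
qed

lemma V_le_V_T:
  assumes x: "x \<in> adapted F n T" and "t \<le> T"
  shows "V t x \<le> V T x"
  using assms(2)
proof (induction rule: inc_induct)
  case (step t) then show ?case using W_le_V[OF x, of "Suc t"] W_Suc[OF x, of t] by simp
qed simp

lemma argmin_V:
  assumes x: "x \<in> adapted F n T" and arg: "argmin_condition M F n T h x"
  shows "t \<le> T \<Longrightarrow> V t x = W0"
proof (induction t)
  have eq: "V t x = W t x" if t: "t \<le> T" for t
  proof -
    have "AE w in M. is_arg_min (\<lambda>v. hc t (cat (D t) (hist n x t w) v) w) (\<lambda>v. v \<in> Rn (n t)) (x t w)"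
      using arg t by (simp add: argmin_condition_def)
    then have "AE w in M. hc t (hist n x (Suc t) w) w = stage_min t (hist n x t w) w"
      using AE_space
    proof eventually_elim
      case (elim w)
      then have "hc t (hist n x (Suc t) w) w \<le> stage_min t (hist n x t w) w"
        by (auto simp: stage_min_def is_arg_min_def not_less intro!: INF_greatest)
      then show ?case using stage_min_le[OF x t elim(2)] by (rule antisym)
    qed
    then show ?thesis unfolding V_def W_def by (rule expect_cong)
  qed
  {
    case 0 then show ?case using eq[of 0] by (simp add: W_0)
  next
    case (Suc t) then show ?case using eq[of "Suc t"] W_Suc[OF x, of t] by simp
  }
qed

section \<open>Existence and characterization of optimal strategies\<close>

definition stage_argmin :: "nat \<Rightarrow> ('a \<Rightarrow> nat \<Rightarrow> real) \<Rightarrow> ('a \<Rightarrow> nat \<Rightarrow> real) \<Rightarrow> bool" where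
  "stage_argmin t u s \<longleftrightarrow>
     (AE w in M. is_arg_min (\<lambda>v. hc t (cat (D t) (u w) v) w) (\<lambda>v. v \<in> Rn (n t)) (s w))"

lemma ex_stage_argmin:
  assumes k: "k \<le> T" and u: "u \<in> measurable (F k) (borel_Rn (D k))"
  shows "\<exists>s\<in>measurable (F k) (borel_Rn (n k)). stage_argmin k u s"
proof -
  interpret complete_subalgebra M "F k" using complete_subalgebra k by simp
  note wd = well_defined[OF k]
  have "normal_integrand (F k) (D k + n k) (hc k)"
    using hcond_cond_integrand[OF k wd] by (simp add: is_cond_integrand_def total_dim_Suc)
  from argmin_selection[OF this horizon_pos[OF k wd, unfolded total_dim_Suc] u]
  show ?thesis unfolding stage_argmin_def .
qed

text \<open>The minimization of block \<open>k\<close> depends on the history fixed before it, so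
  partial strategies are extended forward in time, one block at a time.\<close>

lemma ex_argmin: "\<exists>x\<in>adapted F n T. argmin_condition M F n T h x"
proof -
  have "k \<le> Suc T \<Longrightarrow> \<exists>x. \<forall>t<k. x t \<in> measurable (F t) (borel_Rn (n t)) \<and> stage_argmin t (hist n x t) (x t)" for k
  proof (induction k)
    case (Suc k)
    then obtain x where x: "\<forall>t<k. x t \<in> measurable (F t) (borel_Rn (n t)) \<and> stage_argmin t (hist n x t) (x t)"
      using Suc_leD by blast
    have k: "k \<le> T" using Suc by simp
    have "hist n x k \<in> measurable (F k) (borel_Rn (D k))"
      using x by (intro measurable_hist measurable_F_mono[OF less_imp_le k]) auto
    from ex_stage_argmin[OF k this] obtain s
      where s: "s \<in> measurable (F k) (borel_Rn (n k))" "stage_argmin k (hist n x k) s" by blast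
    \<comment> \<open>A history of length at most \<open>k\<close> reads only blocks below
      \<open>k\<close>, so replacing block \<open>k\<close> preserves the earlier minimizations and
      the problem of stage \<open>k\<close> itself.\<close>
    have "hist n (x(k := s)) t = hist n x t" if "t \<le> k" for t
      using that by (intro ext hist_cong) auto
    then have "\<forall>t<Suc k. (x(k := s)) t \<in> measurable (F t) (borel_Rn (n t)) \<and>
        stage_argmin t (hist n (x(k := s)) t) ((x(k := s)) t)"
      using x s by (auto simp: less_Suc_eq simp del: fun_upd_apply) (auto simp: fun_upd_apply)
    then show ?case by blast
  qed auto
  from this[OF order_refl] obtain x
    where "\<forall>t\<le>T. x t \<in> measurable (F t) (borel_Rn (n t)) \<and> stage_argmin t (hist n x t) (x t)"
    unfolding less_Suc_eq_le by blast
  then show ?thesis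
    by (intro bexI[of _ x]) (simp_all add: adapted_def argmin_condition_def stage_argmin_def)
qed

text \<open>The lower bound comes from the chain of values, attainment from a stagewise minimizing
  strategy.\<close>

lemma inf_P_eq: "inf_P M F n T h = W0"
proof -
  have eq: "inf_P M F n T h = (INF x\<in>adapted F n T. V T x)"
    unfolding inf_P_def by (intro INF_cong refl V_T[symmetric])
  obtain x where x: "x \<in> adapted F n T" "argmin_condition M F n T h x" using ex_argmin by blast
  show ?thesis
  proof (rule antisym)
    show "inf_P M F n T h \<le> W0"
      unfolding eq using argmin_V[OF x order_refl] by (intro INF_lower2[OF x(1)]) simp
    show "W0 \<le> inf_P M F n T h" unfolding eq by (intro INF_greatest W0_le_V order_refl)
  qed
qed

lemma optimal_iff: "x \<in> adapted F n T \<Longrightarrow> optimal M F n T h x \<longleftrightarrow> V T x = W0"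
  by (simp only: optimal_def inf_P_eq V_T) simp

lemma optimal_V: "x \<in> adapted F n T \<Longrightarrow> optimal M F n T h x \<Longrightarrow> t \<le> T \<Longrightarrow> V t x = W0"
  using V_le_V_T[of x t] W0_le_V[of x t] by (simp add: optimal_iff)

text \<open>Optimality turns every inequality between \<open>W t x\<close> and \<open>V t x\<close>
  into an equality, and ordered integrands with equal finite expectation agree almost surely;
  agreement with \<open>stage_min\<close> means that block \<open>t\<close> is a minimizer.\<close>

lemma optimal_argmin:
  assumes x: "x \<in> adapted F n T" and opt: "optimal M F n T h x" and fin: "W0 < \<infinity>"
  shows "argmin_condition M F n T h x"
  unfolding argmin_condition_def
proof (intro allI impI)
  fix t assume t: "t \<le> T"
  interpret complete_subalgebra M "F t" using complete_subalgebra t by simp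
  note wd = well_defined[OF t]
  \<comment> \<open>The value before stage \<open>t\<close> is the value after stage
    \<open>t - 1\<close>, which optimality identifies; at \<open>t = 0\<close> it is
    \<open>W0\<close> already.\<close>
  have W: "W t x = W0"
  proof (cases t)
    case (Suc s)
    then show ?thesis using W_Suc[OF x, of s] optimal_V[OF x opt, of s] t by simp
  qed (simp add: W_0)
  obtain \<mu> where \<mu>: "integrable M \<mu>" "AE w in M. \<forall>u\<in>Rn (D t). ereal (\<mu> w) \<le> stage_min t u w"
    using stage_min_lower_bound[OF t wd] by (auto simp: integrably_bounded_below_def)
  have hM: "hist n x t \<in> measurable M (borel_Rn (D t))"
    using hist_measurable[OF x t, of t] measurable_F_M[OF t] by simp
  have "AE w in M. stage_min t (hist n x t w) w = hc t (hist n x (Suc t) w) w"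
  proof (rule expect_eq_imp_AE_eq)
    show "AE w in M. stage_min t (hist n x t w) w \<le> hc t (hist n x (Suc t) w) w"
      by (intro AE_I2 stage_min_le x t)
    show "AE w in M. ereal (\<mu> w) \<le> stage_min t (hist n x t w) w"
      by (rule AE_lower_compose[OF \<mu>(2) hM])
    show "(\<lambda>w. stage_min t (hist n x t w) w) \<in> borel_measurable M"
      by (rule AE_normal_integrand_compose[OF stage_min_normal[OF t wd] hM])
    have "normal_integrand (F t) (D (Suc t)) (hc t)"
      using hcond_cond_integrand[OF t wd] by (simp add: is_cond_integrand_def)
    from measurable_F_M[OF t normal_integrand_compose[OF this hist_measurable[OF x t order_refl]]]
    show "(\<lambda>w. hc t (hist n x (Suc t) w) w) \<in> borel_measurable M" .
    show "expect M (\<lambda>w. stage_min t (hist n x t w) w) = expect M (\<lambda>w. hc t (hist n x (Suc t) w) w)"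
      using W optimal_V[OF x opt t] by (simp add: V_def W_def)
    show "expect M (\<lambda>w. stage_min t (hist n x t w) w) < \<infinity>" using W fin by (simp add: W_def)
  qed (rule \<mu>(1))
  then show "AE w in M. is_arg_min (\<lambda>v. hc t (cat (D t) (hist n x t w) v) w) (\<lambda>v. v \<in> Rn (n t)) (x t w)"
    using AE_space
  proof eventually_elim
    case (elim w)
    have "stage_min t (hist n x t w) w \<le> hc t (cat (D t) (hist n x t w) v) w" if "v \<in> Rn (n t)" for v
      unfolding stage_min_def using that by (rule INF_lower)
    then have "hc t (cat (D t) (hist n x t w) (x t w)) w \<le> hc t (cat (D t) (hist n x t w) v) w"
      if "v \<in> Rn (n t)" for v
      using that elim(1) by simp
    then show ?case using adapted_in_Rn[OF x t elim(2)] by (auto simp: is_arg_min_def not_less)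
  qed
qed

end

text \<open>If the infimum is \<infinity>, every adapted strategy is optimal, whereas stagewise
  minimization can fail on a set where the values are finite. The argmin condition is therefore
  stated as sufficient in general and as equivalent to optimality when the infimum is below
  \<infinity>.\<close>

theorem theorem4:
  fixes M :: "'a measure" and F :: "nat \<Rightarrow> 'a measure"
    and T :: nat and n :: "nat \<Rightarrow> nat"
    and h :: "(nat \<Rightarrow> real) \<Rightarrow> 'a \<Rightarrow> ereal"
    and m :: "'a \<Rightarrow> real"
  assumes "complete_filtered_prob_space M F T"
    and "normal_integrand M (total_dim n (Suc T)) h"
    and "integrable M m"
    and "AE \<omega> in M. \<forall>x\<in>Rn (total_dim n (Suc T)). ereal (m \<omega>) \<le> h x \<omega>"
    and "\<And>t. t \<le> T \<Longrightarrow> well_defined M F n T h t \<Longrightarrow>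
           AE \<omega> in M. \<forall>v\<in>Rn (n t) - {\<lambda>_. 0}.
             0 < horizon (total_dim n (Suc t)) (\<lambda>z. hcond M F n T h t z \<omega>) (cat (total_dim n t) (\<lambda>_. 0) v)"
  shows "(\<forall>t\<le>T. well_defined M F n T h t) \<and>
    (\<forall>x\<in>adapted F n T. \<forall>t\<le>T.
       inf_P M F n T h \<le> expect M (\<lambda>\<omega>. hcond M F n T h t (hist n x (Suc t) \<omega>) \<omega>)) \<and>
    (\<exists>x. optimal M F n T h x) \<and>
    (\<forall>x\<in>adapted F n T.
       (optimal M F n T h x \<longleftrightarrow>
          (\<forall>t\<le>T. expect M (\<lambda>\<omega>. hcond M F n T h t (hist n x (Suc t) \<omega>) \<omega>) = inf_P M F n T h)) \<and>
       (argmin_condition M F n T h x \<longrightarrow> optimal M F n T h x) \<and>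
       (inf_P M F n T h < \<infinity> \<longrightarrow>
          (optimal M F n T h x \<longleftrightarrow> argmin_condition M F n T h x)))"
proof -
  interpret stochastic_program M F T n h m using assms by unfold_locales
  have arg: "optimal M F n T h x" if "x \<in> adapted F n T" "argmin_condition M F n T h x" for x
    using argmin_V[OF that, of T] that(1) by (simp add: optimal_iff)
  show ?thesis
    unfolding V_def[symmetric] inf_P_eq
    using well_defined W0_le_V arg ex_argmin optimal_argmin optimal_V optimal_iff by blast
qed

end
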